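(* Let $g\ge 12$ be an integer and $k=\lceil (g/2)^{2/3}\rceil+1$. In single-machine non-clairvoyant scheduling with stochastic (Poisson) progress bars of granularity $g$, the Repeated Explore-Then-Commit algorithm with threshold $k$ satisfies, for every instance, $\mathbb{E}[\mathrm{ALG}]\le\big(1+(12/g)^{1/3}\big)\mathrm{OPT}$, where the expectation is over the progress bars.
   Context: Single-machine preemptive scheduling of $n$ jobs available at time $0$ with unknown processing times $p_j>0$, minimizing total completion time $\sum_jC_j$; capacity may be shared arbitrarily among unfinished jobs; $\mathrm{OPT}$ is the optimal value. Stochastic progress bar of granularity $g$: for each job $j$ independently, let $\tilde\beta_j^{(1)}\le\dots\le\tilde\beta_j^{(g)}$ be the first $g$ points of a Poisson point process of rate $g$ on $\mathbb{R}_+$, $\beta_j^{(h)}=\min(1,\tilde\beta_j^{(h)})$ for $h\in[g]$, $\beta_j^{(g+1)}=1$, and $\varphi_j(x)=\frac{1}{g+1}\sum_{h=1}^{g+1}\mathbb{1}(x\ge\beta_j^{(h)})$ for $x\in[0,1]$. The scheduler observes at each time the displayed progress $X_j=\varphi_j(e_j/p_j)$ of each job, where $e_j$ is its elapsed processing. Repeated Explore-Then-Commit with threshold $k$: maintain the set $\mathcal J$ of unfinished jobs; run Round-Robin (equal sharing) on $\mathcal J$; as soon as some $j\in\mathcal J$ has displayed progress at least $k/(g+1)$, run $j$ alone until completion, remove it from $\mathcal J$, and resume Round-Robin. *)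

theory Defs
  imports "HOL-Probability.Probability"
begin

section \<open>Poisson point processes on the half-line\<close>

definition num_points :: "(nat \<Rightarrow> 'w \<Rightarrow> real) \<Rightarrow> real set \<Rightarrow> 'w \<Rightarrow> nat" where
  "num_points T A \<omega> = card {i. T i \<omega> \<in> A}"

text \<open>\<open>T 0 \<le> T 1 \<le> \<dots>\<close> are the points of the process in increasing order, so the point
  usually written with index \<open>h \<ge> 1\<close> is \<open>T (h - 1)\<close>. The divergence to infinity is local
  finiteness; without it \<^const>\<open>num_points\<close> could be the cardinality of an infinite set.\<close>

definition poisson_point_process ::
    "'w measure \<Rightarrow> real \<Rightarrow> (nat \<Rightarrow> 'w \<Rightarrow> real) \<Rightarrow> bool" where
  "poisson_point_process M r T \<longleftrightarrow>
     (\<forall>i. T i \<in> borel_measurable M) \<and>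
     (AE \<omega> in M. (\<forall>i. 0 \<le> T i \<omega> \<and> T i \<omega> \<le> T (Suc i) \<omega>) \<and>
                 filterlim (\<lambda>i. T i \<omega>) at_top sequentially) \<and>
     (\<forall>A m. A \<in> sets borel \<and> A \<subseteq> {0..} \<and> bounded A \<longrightarrow>
        measure M {\<omega> \<in> space M. num_points T A \<omega> = m} =
          exp (- (r * measure lborel A)) * (r * measure lborel A) ^ m / fact m) \<and>
     (\<forall>F. finite F \<and> disjoint F \<and> (\<forall>A\<in>F. A \<in> sets borel \<and> A \<subseteq> {0..} \<and> bounded A) \<longrightarrow>
        prob_space.indep_vars M (\<lambda>_. count_space UNIV) (num_points T) F)"

definition independent_poisson_processes ::
    "'w measure \<Rightarrow> nat \<Rightarrow> real \<Rightarrow> (nat \<Rightarrow> nat \<Rightarrow> 'w \<Rightarrow> real) \<Rightarrow> bool" where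
  "independent_poisson_processes M n r T \<longleftrightarrow>
     (\<forall>j<n. poisson_point_process M r (T j)) \<and>
     prob_space.indep_vars M (\<lambda>_. \<Pi>\<^sub>M i\<in>UNIV. borel) (\<lambda>j \<omega> i. T j i \<omega>) {..<n}"

section \<open>Progress bars\<close>

text \<open>The points of one job are passed as a sequence indexed from 0; the jump positions
  \<open>\<beta>\<^sup>1, \<dots>, \<beta>\<^sup>g\<^sup>+\<^sup>1\<close> are indexed from 1.\<close>

definition bar_jump :: "nat \<Rightarrow> (nat \<Rightarrow> real) \<Rightarrow> nat \<Rightarrow> real" where
  "bar_jump g t h = (if h \<le> g then min 1 (t (h - 1)) else 1)"

definition progress_bar :: "nat \<Rightarrow> (nat \<Rightarrow> real) \<Rightarrow> real \<Rightarrow> real" where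
  "progress_bar g t x = (\<Sum>h = 1..g + 1. of_bool (bar_jump g t h \<le> x)) / (real g + 1)"

section \<open>Preemptive schedules and the optimum\<close>

text \<open>The jobs are the numbers below \<open>n\<close>, \<open>p j\<close> is the processing time of job \<open>j\<close> and
  \<open>r j u\<close> is the share of the machine given to job \<open>j\<close> at time \<open>u\<close>.\<close>

definition processed :: "(nat \<Rightarrow> real \<Rightarrow> real) \<Rightarrow> nat \<Rightarrow> real \<Rightarrow> real" where
  "processed r j u = integral {0..u} (r j)"

definition schedule :: "nat \<Rightarrow> (nat \<Rightarrow> real) \<Rightarrow> (nat \<Rightarrow> real \<Rightarrow> real) \<Rightarrow> bool" where
  "schedule n p r \<longleftrightarrow>
     (\<forall>j<n. r j \<in> borel_measurable borel) \<and>
     (\<forall>j<n. \<forall>u\<ge>0. 0 \<le> r j u \<and> (p j \<le> processed r j u \<longrightarrow> r j u = 0)) \<and>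
     (\<forall>u\<ge>0. (\<Sum>j<n. r j u) \<le> 1) \<and>
     (\<forall>j<n. \<exists>u\<ge>0. p j \<le> processed r j u)"

definition completion_time :: "(nat \<Rightarrow> real) \<Rightarrow> (nat \<Rightarrow> real \<Rightarrow> real) \<Rightarrow> nat \<Rightarrow> real" where
  "completion_time p r j = Inf {u. 0 \<le> u \<and> p j \<le> processed r j u}"

definition OPT :: "nat \<Rightarrow> (nat \<Rightarrow> real) \<Rightarrow> real" where
  "OPT n p = Inf {\<Sum>j<n. completion_time p r j | r. schedule n p r}"

section \<open>Repeated Explore-Then-Commit\<close>

text \<open>\<open>\<phi> j\<close> is the progress bar of job \<open>j\<close>, \<open>\<theta>\<close> the threshold on the displayed progress,
  \<open>J\<close> the set of unfinished jobs and \<open>e\<close> the vector of elapsed processing times.\<close>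

definition ready_jobs ::
    "(nat \<Rightarrow> real \<Rightarrow> real) \<Rightarrow> (nat \<Rightarrow> real) \<Rightarrow> real \<Rightarrow> nat set \<Rightarrow> (nat \<Rightarrow> real) \<Rightarrow> nat set" where
  "ready_jobs \<phi> p \<theta> J e = {j \<in> J. \<theta> \<le> \<phi> j (e j / p j)}"

definition round_robin :: "nat set \<Rightarrow> (nat \<Rightarrow> real) \<Rightarrow> real \<Rightarrow> nat \<Rightarrow> real" where
  "round_robin J e d = (\<lambda>j. if j \<in> J then e j + d / real (card J) else e j)"

text \<open>For a bar with \<open>\<phi> j 1 = 1\<close> and \<open>\<theta> \<le> 1\<close>, no job can finish before it is ready, so that
  Round-Robin never has to be interrupted by a completion. Right-continuity of the bars makes
  the infimum a minimum.\<close>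

definition explore_duration ::
    "(nat \<Rightarrow> real \<Rightarrow> real) \<Rightarrow> (nat \<Rightarrow> real) \<Rightarrow> real \<Rightarrow> nat set \<Rightarrow> (nat \<Rightarrow> real) \<Rightarrow> real" where
  "explore_duration \<phi> p \<theta> J e =
     Inf {d. 0 \<le> d \<and> ready_jobs \<phi> p \<theta> J (round_robin J e d) \<noteq> {}}"

text \<open>A state consists of the current time, the set of unfinished jobs, the elapsed processing
  times and the completion times recorded so far. One step is a Round-Robin phase followed by
  the execution of a ready job until completion; \<open>pick\<close> chooses among simultaneously ready
  jobs.\<close>

type_synonym retc_state = "real \<times> nat set \<times> (nat \<Rightarrow> real) \<times> (nat \<Rightarrow> real)"

fun retc_step ::
    "(nat set \<Rightarrow> nat) \<Rightarrow> (nat \<Rightarrow> real \<Rightarrow> real) \<Rightarrow> (nat \<Rightarrow> real) \<Rightarrow> real \<Rightarrow> retc_state \<Rightarrow> retc_state" where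
  "retc_step pick \<phi> p \<theta> (u, J, e, C) =
     (let d = explore_duration \<phi> p \<theta> J e;
          e' = round_robin J e d;
          j = pick (ready_jobs \<phi> p \<theta> J e');
          u' = u + d + (p j - e' j)
      in (u', J - {j}, e'(j := p j), C(j := u')))"

definition retc_completion_times ::
    "(nat set \<Rightarrow> nat) \<Rightarrow> (nat \<Rightarrow> real \<Rightarrow> real) \<Rightarrow> nat \<Rightarrow> (nat \<Rightarrow> real) \<Rightarrow> real \<Rightarrow> nat \<Rightarrow> real" where
  "retc_completion_times pick \<phi> n p \<theta> =
     (case (retc_step pick \<phi> p \<theta> ^^ n) (0, {..<n}, \<lambda>_. 0, \<lambda>_. 0) of (u, J, e, C) \<Rightarrow> C)"

definition retc_cost ::
    "(nat set \<Rightarrow> nat) \<Rightarrow> (nat \<Rightarrow> real \<Rightarrow> real) \<Rightarrow> nat \<Rightarrow> (nat \<Rightarrow> real) \<Rightarrow> real \<Rightarrow> real" where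
  "retc_cost pick \<phi> n p \<theta> = (\<Sum>j<n. retc_completion_times pick \<phi> n p \<theta> j)"

end

theory Submission
  imports Defs
begin

text \<open>Let \<open>a j\<close> be the elapsed time at which job \<open>j\<close> passes the threshold. The algorithm finishes
  the jobs in the order of increasing \<open>a\<close>; compared with \<open>\<Sum>j. p j\<close>, two jobs of which \<open>i\<close> is
  finished first contribute \<open>p i + a i\<close> to the cost, while they contribute at least
  \<open>min (p i) (p j)\<close> in every schedule. So it suffices to bound the expected contribution of one
  pair \<open>p i \<le> p j\<close>, which is at most \<open>p i + E (a i) + (p j - p i) * P (a j \<le> a i)\<close>. Up to
  truncation, \<open>a i / p i\<close> and \<open>a j / p j\<close> are independent Erlang variables of shape \<open>k\<close> and rate
  \<open>g\<close>. Hence \<open>E (a i) \<le> p i * k / g\<close>, and with \<open>x = p j / p i\<close> a Chernoff bound gives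
  \<open>P (a j \<le> a i) \<le> (4 * x / (x + 1)\<^sup>2) ^ k\<close>. What remains is an inequality in \<open>g\<close> and \<open>x\<close>.\<close>

section \<open>The scalar inequality\<close>

text \<open>Weighted AM-GM: divided by their values at the maximiser, the two factors become
  \<open>A\<close> and \<open>B\<close> with \<open>A + K * B = K + 1\<close>, and
  \<open>z \<le> exp (z - 1)\<close> applied to both gives \<open>A * B ^ K \<le> 1\<close>.\<close>

lemma shifted_mult_power_le:
  fixes s u :: real
  assumes "0 \<le> s + u" "u \<le> 1" "0 < 1 + s" "0 < K"
  shows "(s + u) * (1 - u) ^ K \<le> (1 + s) ^ Suc K * real K ^ K / (real K + 1) ^ Suc K"
proof -
  define A where "A = (s + u) * (real K + 1) / (1 + s)"
  define B where "B = (1 - u) * (real K + 1) / (real K * (1 + s))"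
  have AB: "0 \<le> A" "0 \<le> B" using assms by (auto simp: A_def B_def)
  have "A + real K * B = real K + 1"
  proof -
    have "real K * B = (1 - u) * (real K + 1) / (1 + s)"
      using assms by (simp add: B_def)
    hence "A + real K * B = ((s + u) + (1 - u)) * (real K + 1) / (1 + s)"
      unfolding A_def by (simp only: add_divide_distrib distrib_right)
    also have "(s + u) + (1 - u) = 1 + s" by simp
    also have "(1 + s) * (real K + 1) / (1 + s) = real K + 1" using assms by simp
    finally show ?thesis .
  qed
  moreover have "A \<le> exp (A - 1)" "B \<le> exp (B - 1)"
    using exp_ge_add_one_self[of "A - 1"] exp_ge_add_one_self[of "B - 1"] by simp_all
  hence "A * B ^ K \<le> exp (A - 1) * exp (B - 1) ^ K"
    using AB by (intro mult_mono power_mono) auto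
  moreover have "exp (A - 1) * exp (B - 1) ^ K = exp (A + real K * B - (real K + 1))"
    by (simp add: exp_of_nat_mult [symmetric] exp_add [symmetric] algebra_simps)
  ultimately have "A * B ^ K \<le> 1" by simp
  hence "A * B ^ K * ((1 + s) ^ Suc K * real K ^ K / (real K + 1) ^ Suc K)
      \<le> 1 * ((1 + s) ^ Suc K * real K ^ K / (real K + 1) ^ Suc K)"
    using assms by (intro mult_right_mono) auto
  also have "A * B ^ K * ((1 + s) ^ Suc K * real K ^ K / (real K + 1) ^ Suc K)
      = (A * (1 + s) / (real K + 1)) * (B * (real K * (1 + s)) / (real K + 1)) ^ K"
    by (simp add: power_divide power_mult_distrib)
  also have "A * (1 + s) / (real K + 1) = s + u"
    using assms by (simp add: A_def)
  also have "B * (real K * (1 + s)) / (real K + 1) = 1 - u"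
    using assms by (simp add: B_def)
  finally show ?thesis by simp
qed

text \<open>The right side is the chord of the convex cube through \<open>a\<close> and
  \<open>b\<close>. It turns the cubic inequalities in \<open>w\<close> below into linear
  ones.\<close>

lemma cube_le_chord:
  fixes a b w :: real
  assumes "a \<le> w" "w \<le> b" "0 \<le> a"
  shows "w ^ 3 \<le> (a\<^sup>2 + a * b + b\<^sup>2) * w - a * b * (a + b)"
proof -
  have "0 \<le> (w - a) * (b - w) * (w + a + b)" using assms by simp
  thus ?thesis by (simp add: power2_eq_square power3_eq_cube algebra_simps)
qed

text \<open>Replaces \<open>2 * t\<close> by \<open>c + t\<^sup>2 / c\<close> to obtain a function of \<open>t\<^sup>2\<close>; a good \<open>c\<close> is the maximiser.\<close>

lemma chernoff_profile_le:
  fixes c t :: real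
  assumes "0 < c" "0 \<le> t" "t < 1" "0 < K"
  shows "2 * t * (1 + t) * (1 - t\<^sup>2) ^ K
    \<le> (2 + 1 / c) * ((1 + c\<^sup>2 / (2 * c + 1)) ^ Suc K * real K ^ K / (real K + 1) ^ Suc K)"
proof -
  have "0 \<le> (t - c)\<^sup>2 / c" using assms by simp
  hence "2 * t \<le> c + t\<^sup>2 / c" using assms by (simp add: field_simps power2_eq_square)
  hence "2 * t * (1 + t) \<le> c + t\<^sup>2 / c + 2 * t\<^sup>2"
    by (simp add: algebra_simps power2_eq_square)
  \<comment> \<open>The bound is now affine in \<open>u = t\<^sup>2\<close>, the form that
    \<open>shifted_mult_power_le\<close> maximises, with
    \<open>s = c\<^sup>2 / (2 * c + 1)\<close>.\<close>
  also have "\<dots> = (2 + 1 / c) * (c\<^sup>2 / (2 * c + 1) + t\<^sup>2)"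
  proof -
    have "2 + 1 / c = (2 * c + 1) / c" using assms by (simp add: field_simps)
    hence "(2 + 1 / c) * (c\<^sup>2 / (2 * c + 1)) = c"
      using assms by (simp add: power2_eq_square)
    thus ?thesis by (simp add: distrib_left distrib_right)
  qed
  finally have "2 * t * (1 + t) * (1 - t\<^sup>2) ^ K
      \<le> (2 + 1 / c) * (c\<^sup>2 / (2 * c + 1) + t\<^sup>2) * (1 - t\<^sup>2) ^ K"
    using assms by (intro mult_right_mono) (auto simp: power_le_one)
  also have "\<dots> = (2 + 1 / c) * ((c\<^sup>2 / (2 * c + 1) + t\<^sup>2) * (1 - t\<^sup>2) ^ K)" by simp
  also have "\<dots> \<le> (2 + 1 / c) * ((1 + c\<^sup>2 / (2 * c + 1)) ^ Suc K * real K ^ K / (real K + 1) ^ Suc K)"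
    using assms by (intro mult_left_mono shifted_mult_power_le) (auto simp: power_le_one add_pos_nonneg)
  finally show ?thesis .
qed

text \<open>The suprema are 1 / sqrt (2e) and 1 / e, attained at y = 1 / sqrt 2 and y = 1. The
  constants carry the slack from bounding e below by squaring the Taylor bound for
  \<open>exp (1 / 4)\<close> twice.\<close>

lemma mult_exp_neg_square_le:
  fixes y :: real
  shows "y * exp (- (y\<^sup>2)) \<le> 0.4308" "y\<^sup>2 * exp (- (y\<^sup>2)) \<le> 0.3711"
proof -
  have q: "1.28125 \<le> exp (1 / 4 :: real)"
    using exp_lower_Taylor_quadratic[of "1 / 4 :: real"] by (simp add: power2_eq_square)
  have h: "(1.6416 :: real) \<le> exp (1 / 2)"
    using power_mono[OF q, of 2] by (simp add: exp_of_nat_mult [symmetric] power2_eq_square flip: exp_add)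
  have o: "(2.6948 :: real) \<le> exp 1"
    using power_mono[OF h, of 2] by (simp add: power2_eq_square flip: exp_add)
  \<comment> \<open>\<open>0.7071\<close> is 1 / sqrt 2 rounded down, so its square is at most
    1/2.\<close>
  have "0 \<le> (y - 0.7071)\<^sup>2" by simp
  hence "1.4142 * y \<le> 1 + (y\<^sup>2 - 1 / 2)" by (simp add: power2_eq_square algebra_simps)
  also have "\<dots> \<le> exp (y\<^sup>2 - 1 / 2)" by (rule exp_ge_add_one_self)
  finally have 1: "1.4142 * (y * exp (- (y\<^sup>2))) \<le> exp (y\<^sup>2 - 1 / 2) * exp (- (y\<^sup>2))"
    by (simp add: mult_right_mono)
  also have "exp (y\<^sup>2 - 1 / 2) * exp (- (y\<^sup>2)) = exp (- (1 / 2))"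
    by (simp flip: exp_add)
  also have "\<dots> = 1 / exp (1 / 2)" by (simp only: exp_minus divide_inverse mult_1_left)
  also have "\<dots> \<le> 1 / 1.6416" using h by (intro divide_left_mono) auto
  finally show "y * exp (- (y\<^sup>2)) \<le> 0.4308" by simp
  have "y\<^sup>2 \<le> exp (y\<^sup>2 - 1)" using exp_ge_add_one_self[of "y\<^sup>2 - 1"] by simp
  hence "y\<^sup>2 * exp (- (y\<^sup>2)) \<le> exp (y\<^sup>2 - 1) * exp (- (y\<^sup>2))"
    by (intro mult_right_mono) auto
  also have "exp (y\<^sup>2 - 1) * exp (- (y\<^sup>2)) = exp (- 1)"
    by (simp flip: exp_add)
  also have "\<dots> = 1 / exp 1" by (simp only: exp_minus divide_inverse mult_1_left)
  also have "\<dots> \<le> 1 / 2.6948" using o by (intro divide_left_mono) auto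
  finally show "y\<^sup>2 * exp (- (y\<^sup>2)) \<le> 0.3711" by simp
qed

text \<open>With \<open>t = y / sqrt K\<close> the power is at most
  \<open>exp (- y\<^sup>2)\<close>, so the first term is at most 1.1422 / sqrt K, hence at most
  \<open>1.1422 * w\<close>. For \<open>7 \<le> K\<close> also
  \<open>(K + 1) * w\<^sup>2 \<le> 4 / 3\<close>, so the second term is at most
  \<open>2 / 3 * w\<close>.\<close>

lemma threshold_bound_large:
  fixes t w :: real
  assumes "0 \<le> t" "t < 1" "0 < w" "1 \<le> real K * w\<^sup>2" "(real K - 1) * w\<^sup>2 \<le> 1" "7 \<le> K"
  shows "2 * t * (1 + t) * (1 - t\<^sup>2) ^ K + (real K + 1) / 2 * w ^ 3 \<le> 1.817 * w"
proof -
  define q where "q = 1 / sqrt K"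
  have q: "0 < q" "q\<^sup>2 * K = 1" using assms by (auto simp: q_def power_divide)
  have "q\<^sup>2 \<le> (0.378)\<^sup>2"
  proof -
    have "q\<^sup>2 = 1 / real K" using q assms by (simp add: field_simps)
    also have "\<dots> \<le> 1 / 7" using assms by (intro divide_left_mono) auto
    finally show ?thesis by (simp add: power2_eq_square)
  qed
  hence q378: "q \<le> 0.378" by (rule power2_le_imp_le) simp
  have "q\<^sup>2 \<le> w\<^sup>2"
  proof -
    have "q\<^sup>2 = 1 / real K" using q assms by (simp add: field_simps)
    also have "\<dots> \<le> w\<^sup>2" using assms by (simp add: field_simps)
    finally show ?thesis .
  qed
  hence qw: "q \<le> w" by (rule power2_le_imp_le) (use assms in simp)
  define y where "y = t / q"
  have ty: "t = q * y" using q by (simp add: y_def)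
  have "(1 - t\<^sup>2) ^ K \<le> exp (- (t\<^sup>2)) ^ K"
    using assms exp_ge_add_one_self[of "- (t\<^sup>2)"] by (intro power_mono) (auto simp: power_le_one)
  also have "\<dots> = exp (- (K * t\<^sup>2))" by (simp flip: exp_of_nat_mult)
  also have "K * t\<^sup>2 = y\<^sup>2" using q by (simp add: ty power_mult_distrib mult.commute mult.left_commute)
  finally have "2 * t * (1 + t) * (1 - t\<^sup>2) ^ K \<le> 2 * t * (1 + t) * exp (- (y\<^sup>2))"
    using assms by (intro mult_left_mono) auto
  also have "\<dots> = q * (2 * (y * exp (- (y\<^sup>2))) + 2 * q * (y\<^sup>2 * exp (- (y\<^sup>2))))"
    by (simp add: ty power2_eq_square algebra_simps)
  also have "\<dots> \<le> q * (2 * 0.4308 + 2 * q * 0.3711)"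
    using q mult_exp_neg_square_le[of y] by (intro mult_left_mono add_mono) auto
  also have "\<dots> \<le> q * 1.1422"
    using q q378 by (intro mult_left_mono) auto
  also have "\<dots> \<le> w * 1.1422" using qw by simp
  finally have 1: "2 * t * (1 + t) * (1 - t\<^sup>2) ^ K \<le> w * 1.1422" .
  have "(real K + 1) * w\<^sup>2 \<le> 4 / 3"
  proof -
    have "6 * w\<^sup>2 \<le> (real K - 1) * w\<^sup>2" using assms by (intro mult_right_mono) auto
    moreover have "(real K + 1) * w\<^sup>2 = (real K - 1) * w\<^sup>2 + 2 * w\<^sup>2" by (simp add: algebra_simps)
    ultimately show ?thesis using assms(5) by linarith
  qed
  hence "(real K + 1) * w\<^sup>2 * w \<le> 4 / 3 * w" using assms by (intro mult_right_mono) auto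
  hence "(real K + 1) / 2 * w ^ 3 \<le> 2 / 3 * w" by (simp add: power3_eq_cube power2_eq_square algebra_simps)
  with 1 show ?thesis using assms by simp
qed

text \<open>For \<open>K\<close> equal to 4, 5 or 6 the exponential estimate gives a constant above
  \<open>1.817\<close>, so these cases use the sharper \<open>chernoff_profile_le\<close>. The
  target \<open>1.817\<close> is the cube root of 6 rounded down.\<close>

lemma threshold_bound:
  fixes t w :: real
  assumes t: "0 \<le> t" "t < 1" and w: "0 < w" "w ^ 3 \<le> 1 / 6"
    and K: "1 \<le> real K * w\<^sup>2" "(real K - 1) * w\<^sup>2 \<le> 1"
  shows "2 * t * (1 + t) * (1 - t\<^sup>2) ^ K + (real K + 1) / 2 * w ^ 3 \<le> 1.817 * w"
proof -
  \<comment> \<open>The cube root of 1/6 rounded up; it is small enough to rule out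
    \<open>K \<le> 3\<close>.\<close>
  have w': "w \<le> 0.551"
  proof (rule ccontr)
    assume "\<not> w \<le> 0.551"
    hence "0.551 ^ 3 < w ^ 3" by (intro power_strict_mono) auto
    with w show False by (simp add: power3_eq_cube)
  qed
  have "3 < K"
  proof (rule ccontr)
    assume "\<not> 3 < K"
    hence "real K * w\<^sup>2 \<le> 3 * 0.551\<^sup>2" using w w' by (intro mult_mono power_mono) auto
    with K show False by (simp add: power2_eq_square)
  qed
  then consider "K = 4" | "K = 5" | "K = 6" | "7 \<le> K" by linarith
  thus ?thesis
  proof cases
    case 1
    \<comment> \<open>In each of the three small cases \<open>w\<close> lies in a short interval, on
      which the cube is replaced by its chord. The values \<open>3/8\<close>, \<open>1/3\<close>,
      \<open>1/3\<close> given to \<open>chernoff_profile_le\<close> are near the maximiser, the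
      positive root of \<open>2 * (K + 1) * t\<^sup>2 = t + 1\<close>.\<close>
    have "1/2 \<le> w" by (rule power2_le_imp_le) (use 1 K w in \<open>auto simp: power2_eq_square\<close>)
    with cube_le_chord[of "1/2" w "0.551"] w' have "0.5627 + 5 / 2 * w ^ 3 \<le> 1.817 * w"
      by (simp add: power2_eq_square)
    moreover have "2 * t * (1 + t) * (1 - t\<^sup>2) ^ K \<le> 0.5627"
      using chernoff_profile_le[of "3/8" t 4] t 1 by (simp add: power2_eq_square eval_nat_numeral)
    ultimately show ?thesis using 1 by simp
  next
    case 2
    have "0.447 \<le> w" by (rule power2_le_imp_le) (use 2 K w in \<open>auto simp: power2_eq_square\<close>)
    moreover have "w \<le> 1/2" by (rule power2_le_imp_le) (use 2 K w in \<open>auto simp: power2_eq_square\<close>)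
    ultimately have "0.4934 + 3 * w ^ 3 \<le> 1.817 * w"
      using cube_le_chord[of "0.447" w "1/2"] by (simp add: power2_eq_square)
    moreover have "2 * t * (1 + t) * (1 - t\<^sup>2) ^ K \<le> 0.4934"
      using chernoff_profile_le[of "1/3" t 5] t 2 by (simp add: power2_eq_square eval_nat_numeral)
    ultimately show ?thesis using 2 by simp
  next
    case 3
    have "0.408 \<le> w" by (rule power2_le_imp_le) (use 3 K w in \<open>auto simp: power2_eq_square\<close>)
    moreover have "w \<le> 0.4473" by (rule power2_le_imp_le) (use 3 K w in \<open>auto simp: power2_eq_square\<close>)
    ultimately have "0.446 + 7 / 2 * w ^ 3 \<le> 1.817 * w"
      using cube_le_chord[of "0.408" w "0.4473"] by (simp add: power2_eq_square)
    moreover have "2 * t * (1 + t) * (1 - t\<^sup>2) ^ K \<le> 0.446"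
      using chernoff_profile_le[of "1/3" t 6] t 3 by (simp add: power2_eq_square eval_nat_numeral)
    ultimately show ?thesis using 3 by simp
  next
    case 4
    thus ?thesis using assms by (intro threshold_bound_large) auto
  qed
qed

text \<open>At the worst \<open>x\<close> the first term is of order 1 / sqrt K, while the second is
  about K / g; taking \<open>K\<close> of order g^(2/3) balances them. In terms of \<open>w\<close>
  the ceiling defining \<open>K\<close> says that \<open>K * w\<^sup>2\<close> is at least 1 and
  \<open>(K - 1) * w\<^sup>2\<close> at most 1.\<close>

lemma etc_ratio_bound:
  fixes g K :: nat and x :: real
  assumes "12 \<le> g" and K: "K = nat \<lceil>(real g / 2) powr (2 / 3)\<rceil>" and "1 < x"
  shows "(x - 1) * (4 * x / (x + 1)\<^sup>2) ^ Suc K + (real K + 1) / real g \<le> (12 / real g) powr (1 / 3)"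
proof -
  define w where "w = (2 / real g) powr (1 / 3)"
  have g: "0 < real g" "0 < 2 / real g" using assms by auto
  have w: "0 < w" using g by (simp add: w_def)
  have w3: "w ^ 3 = 2 / real g" using g by (simp add: w_def powr_power)
  have w2: "w\<^sup>2 = (2 / real g) powr (2 / 3)" using g by (simp add: w_def powr_power)
  have inv: "(real g / 2) powr (2 / 3) * w\<^sup>2 = 1"
    using g by (simp add: w2 flip: powr_mult)
  have Kc: "real K = of_int \<lceil>(real g / 2) powr (2 / 3)\<rceil>"
  proof -
    have "0 \<le> \<lceil>(real g / 2) powr (2 / 3)\<rceil>"
      by (metis ceiling_mono ceiling_zero powr_ge_zero)
    thus ?thesis using K by simp
  qed
  have K1: "1 \<le> real K * w\<^sup>2"
    unfolding inv[symmetric] Kc by (intro mult_right_mono) auto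
  have K2: "(real K - 1) * w\<^sup>2 \<le> 1"
  proof -
    have "real K - 1 \<le> (real g / 2) powr (2 / 3)" unfolding Kc by linarith
    hence "(real K - 1) * w\<^sup>2 \<le> (real g / 2) powr (2 / 3) * w\<^sup>2" by (rule mult_right_mono) simp
    thus ?thesis unfolding inv .
  qed
  \<comment> \<open>Then \<open>4 * x / (x + 1)\<^sup>2 = 1 - t\<^sup>2\<close>. The factor
    \<open>x - 1\<close> absorbs one of the \<open>Suc K\<close> powers, which leaves the exponent
    \<open>K\<close>.\<close>
  define t where "t = (x - 1) / (x + 1)"
  have t: "0 \<le> t" "t < 1" using assms by (auto simp: t_def)
  have t1: "1 - t\<^sup>2 = 4 * x / (x + 1)\<^sup>2"
    using assms by (simp add: t_def power_divide field_simps) (simp add: power2_eq_square algebra_simps)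
  have t2: "2 * t * (1 + t) = (x - 1) * (4 * x / (x + 1)\<^sup>2)"
    using assms by (simp add: t_def field_simps power2_eq_square)
  have "(x - 1) * (4 * x / (x + 1)\<^sup>2) ^ Suc K + (real K + 1) / real g
      = 2 * t * (1 + t) * (1 - t\<^sup>2) ^ K + (real K + 1) / 2 * w ^ 3"
    unfolding t2 t1 w3 using g by (simp add: field_simps)
  also have "\<dots> \<le> 1.817 * w"
    using t w K1 K2 assms(1) by (intro threshold_bound) (auto simp: w3)
  also have "\<dots> \<le> 6 powr (1 / 3) * w"
  proof -
    have "(1.817 powr 3) powr (1 / 3) \<le> (6 :: real) powr (1 / 3)"
      by (intro powr_mono2) (auto simp: power3_eq_cube)
    hence "1.817 \<le> (6 :: real) powr (1 / 3)" by (simp only: powr_powr) simp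
    thus ?thesis using w by simp
  qed
  also have "\<dots> = (12 / real g) powr (1 / 3)"
    using g by (simp add: w_def flip: powr_mult)
  finally show ?thesis .
qed

section \<open>The optimum\<close>

text \<open>The cost of the shortest-processing-time-first order, written over unordered
  pairs.\<close>

definition opt_lower_bound :: "nat \<Rightarrow> (nat \<Rightarrow> real) \<Rightarrow> real" where
  "opt_lower_bound n p = (\<Sum>j<n. p j) + (\<Sum>(i, j)\<in>{(i, j). i < j \<and> j < n}. min (p i) (p j))"

lemma schedule_rate_le_one:
  assumes "schedule n p r" "j < n" "0 \<le> u"
  shows "0 \<le> r j u" "r j u \<le> 1"
proof -
  show nn: "0 \<le> r j u" using assms unfolding schedule_def by blast
  have "r j u \<le> (\<Sum>i<n. r i u)"
    using assms unfolding schedule_def by (intro member_le_sum) auto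
  also have "\<dots> \<le> 1" using assms unfolding schedule_def by blast
  finally show "r j u \<le> 1" .
qed

lemma schedule_integrable:
  assumes "schedule n p r" "j < n"
  shows "r j integrable_on {0..u}"
proof (rule measurable_bounded_by_integrable_imp_integrable_real)
  show "r j \<in> borel_measurable (lebesgue_on {0..u})"
    using assms unfolding schedule_def
    by (intro measurable_restrict_space1 measurable_completion) simp
  show "\<bar>r j v\<bar> \<le> 1" if "v \<in> {0..u}" for v
    using schedule_rate_le_one[OF assms, of v] that by simp
qed auto

lemma processed_mono:
  assumes "schedule n p r" "j < n" "0 \<le> u" "u \<le> v"
  shows "processed r j u \<le> processed r j v"
  unfolding processed_def
proof (rule integral_subset_le)
  show "\<forall>x\<in>{0..v}. 0 \<le> r j x"
    by (intro ballI schedule_rate_le_one(1)[OF assms(1,2)]) simp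
qed (use assms schedule_integrable[OF assms(1,2)] in auto)

lemma processed_nonneg:
  assumes "schedule n p r" "j < n"
  shows "0 \<le> processed r j u"
  unfolding processed_def
proof (rule integral_nonneg)
  show "0 \<le> r j x" if "x \<in> {0..u}" for x
    using that by (intro schedule_rate_le_one(1)[OF assms]) simp
qed (rule schedule_integrable[OF assms])

text \<open>The processed amount is continuous in time, so the completed times up to some completed
  time \<open>v\<close> form a closed set, which contains its infimum; cutting off at
  \<open>v\<close> does not change the infimum.\<close>

lemma completion_time_attained:
  assumes "schedule n p r" "j < n"
  shows "0 \<le> completion_time p r j" "p j \<le> processed r j (completion_time p r j)"
proof -
  define S where "S = {u. 0 \<le> u \<and> p j \<le> processed r j u}"
  obtain v where v: "v \<in> S" using assms unfolding schedule_def S_def by blast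
  have bdd: "bdd_below S" unfolding S_def by (intro bdd_belowI[of _ 0]) auto
  have cont: "continuous_on {0..v} (processed r j)"
    unfolding processed_def using schedule_integrable[OF assms] by (intro indefinite_integral_continuous_1)
  have Sv: "S \<inter> {0..v} = {u \<in> {0..v}. p j \<le> processed r j u}" by (auto simp: S_def)
  have "closed (S \<inter> {0..v})"
    unfolding Sv using cont by (intro continuous_on_closed_Collect_le) auto
  moreover have "S \<inter> {0..v} \<noteq> {}" using v by (auto simp: S_def)
  moreover have "bdd_below (S \<inter> {0..v})" using bdd by (rule bdd_below_mono) auto
  ultimately have "Inf (S \<inter> {0..v}) \<in> S \<inter> {0..v}" by (intro closed_contains_Inf)
  moreover have "Inf (S \<inter> {0..v}) = Inf S"
  proof (rule antisym)
    show "Inf S \<le> Inf (S \<inter> {0..v})" using bdd v by (intro cInf_superset_mono) (auto simp: S_def)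
    show "Inf (S \<inter> {0..v}) \<le> Inf S"
    proof (rule cInf_greatest)
      fix x assume "x \<in> S"
      show "Inf (S \<inter> {0..v}) \<le> x"
      proof (cases "x \<le> v")
        case True
        with \<open>x \<in> S\<close> show ?thesis using \<open>bdd_below (S \<inter> {0..v})\<close>
          by (intro cInf_lower) (auto simp: S_def)
      next
        case False
        with \<open>Inf (S \<inter> {0..v}) \<in> S \<inter> {0..v}\<close> show ?thesis by auto
      qed
    qed (use v in auto)
  qed
  ultimately have "Inf S \<in> S" by auto
  thus "0 \<le> completion_time p r j" "p j \<le> processed r j (completion_time p r j)"
    unfolding completion_time_def S_def by auto
qed

lemma sum_processed_le:
  assumes "schedule n p r" "0 \<le> u"
  shows "(\<Sum>j<n. processed r j u) \<le> u"
proof -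
  have "(\<Sum>j<n. processed r j u) = integral {0..u} (\<lambda>v. \<Sum>j<n. r j v)"
    unfolding processed_def using schedule_integrable[OF assms(1)] by (subst integral_sum) auto
  also have "\<dots> \<le> integral {0..u} (\<lambda>_. 1)"
    using schedule_integrable[OF assms(1)] assms unfolding schedule_def
    by (intro integral_le integrable_sum) auto
  also have "\<dots> = u" using assms by simp
  finally show ?thesis .
qed

text \<open>Applied to the work done on one job by the time another completes, it gives the shape of
  \<open>opt_lower_bound\<close>.\<close>

lemma sum_square_split:
  fixes f :: "nat \<Rightarrow> nat \<Rightarrow> 'a :: comm_monoid_add"
  shows "(\<Sum>i<n. \<Sum>j<n. f i j)
    = (\<Sum>j<n. f j j) + (\<Sum>(i, j)\<in>{(i, j). i < j \<and> j < n}. f i j + f j i)"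
proof (induction n)
  case (Suc n)
  have "{(i, j). i < j \<and> j < Suc n} = {(i, j). i < j \<and> j < n} \<union> (\<lambda>i. (i, n)) ` {..<n}"
    by (auto simp: less_Suc_eq)
  moreover have "finite {(i, j). i < j \<and> j < n}"
    by (rule finite_subset[of _ "{..<n} \<times> {..<n}"]) auto
  ultimately have "(\<Sum>(i, j)\<in>{(i, j). i < j \<and> j < Suc n}. f i j + f j i)
      = (\<Sum>(i, j)\<in>{(i, j). i < j \<and> j < n}. f i j + f j i) + (\<Sum>i<n. f i n + f n i)"
    by (simp add: sum.union_disjoint disjoint_iff sum.reindex inj_on_def image_iff)
  thus ?case by (simp add: Suc sum.distrib ac_simps)
qed simp

text \<open>Of any two jobs, the one completed first is completely processed when the other one
  completes.\<close>

lemma opt_lower_bound_le_schedule: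
  assumes "schedule n p r"
  shows "opt_lower_bound n p \<le> (\<Sum>j<n. completion_time p r j)"
proof -
  let ?C = "completion_time p r"
  note C = completion_time_attained[OF assms]
  have "opt_lower_bound n p \<le> (\<Sum>j<n. processed r j (?C j))
      + (\<Sum>(i, j)\<in>{(i, j). i < j \<and> j < n}. processed r j (?C i) + processed r i (?C j))"
    unfolding opt_lower_bound_def
  proof (intro add_mono sum_mono)
    fix ij assume "ij \<in> {(i, j). i < j \<and> j < n}"
    then obtain i j where ij: "ij = (i, j)" "i < n" "j < n" by auto
    have "min (p i) (p j) \<le> processed r j (?C i) + processed r i (?C j)"
    proof (cases "?C i \<le> ?C j")
      case True
      have "p i \<le> processed r i (?C j)"
        using C[OF ij(2)] processed_mono[OF assms ij(2) _ True] by linarith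
      thus ?thesis using processed_nonneg[OF assms ij(3), of "?C i"] by linarith
    next
      case False
      have "p j \<le> processed r j (?C i)"
        using C[OF ij(3)] processed_mono[OF assms ij(3), of "?C j" "?C i"] False by linarith
      thus ?thesis using processed_nonneg[OF assms ij(2), of "?C j"] by linarith
    qed
    thus "(case ij of (i, j) \<Rightarrow> min (p i) (p j))
        \<le> (case ij of (i, j) \<Rightarrow> processed r j (?C i) + processed r i (?C j))"
      by (simp add: ij)
  qed (use C in auto)
  also have "\<dots> = (\<Sum>i<n. \<Sum>j<n. processed r j (?C i))"
    by (rule sum_square_split [symmetric])
  also have "\<dots> \<le> (\<Sum>i<n. ?C i)"
    using C by (intro sum_mono sum_processed_le[OF assms]) auto
  finally show ?thesis .
qed

text \<open>Run the jobs one after another by index. This makes the set whose infimum is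
  \<open>OPT\<close> nonempty.\<close>

lemma schedule_exists:
  assumes "\<And>j. j < n \<Longrightarrow> 0 < p j"
  shows "\<exists>r. schedule n p r"
proof -
  define s where "s j = (\<Sum>i<j. p i)" for j
  \<comment> \<open>Half-open intervals, because a job must have rate 0 at the moment of its
    completion.\<close>
  define r :: "nat \<Rightarrow> real \<Rightarrow> real" where "r j = indicator {s j..<s (Suc j)}" for j
  have s_mono: "s i \<le> s j" if "i \<le> j" "j \<le> n" for i j
    unfolding s_def using that assms by (intro sum_mono2) (auto intro: less_imp_le)
  have s_nn: "0 \<le> s j" if "j \<le> n" for j
    using s_mono[of 0 j] that by (simp add: s_def)
  have proc: "processed r j u = min u (s (Suc j)) - s j" if "j < n" "s j \<le> u" for j u
  proof -
    let ?I = "{s j..min u (s (Suc j))}"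
    have "((\<lambda>_. 1) has_integral (min u (s (Suc j)) - s j)) ?I"
      using that s_mono[of j "Suc j"] has_integral_const_real[of "1 :: real" "s j" "min u (s (Suc j))"] by simp
    hence "((\<lambda>v. if v \<in> ?I then 1 else 0) has_integral (min u (s (Suc j)) - s j)) {0..u}"
      using s_nn[of j] that by (subst has_integral_restrict) auto
    hence "(r j has_integral (min u (s (Suc j)) - s j)) {0..u}"
      by (rule has_integral_spike[of "{s (Suc j)}", rotated 2]) (auto simp: r_def indicator_def)
    thus ?thesis unfolding processed_def by (rule integral_unique)
  qed
  have "schedule n p r" unfolding schedule_def
  proof (intro conjI allI impI)
    fix j u assume j: "j < n" and u: "0 \<le> (u::real)"
    show "0 \<le> r j u" by (simp add: r_def)
    assume *: "p j \<le> processed r j u"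
    show "r j u = 0"
    proof (rule ccontr)
      assume "r j u \<noteq> 0"
      hence "s j \<le> u" "u < s (Suc j)" by (auto simp: r_def indicator_def split: if_splits)
      with proc[OF j] * show False by (simp add: s_def)
    qed
  next
    fix u :: real
    have "(\<Sum>j<n. r j u) = indicator (\<Union>j<n. {s j..<s (Suc j)}) u"
      unfolding r_def
    proof (rule indicator_UN_disjoint [symmetric])
      have "{s i..<s (Suc i)} \<inter> {s j..<s (Suc j)} = {}" if "i < j" "j < n" for i j
        using s_mono[of "Suc i" j] that by auto
      thus "disjoint_family_on (\<lambda>j. {s j..<s (Suc j)}) {..<n}"
        unfolding disjoint_family_on_def by (metis inf_commute lessThan_iff linorder_neqE_nat)
    qed simp
    thus "(\<Sum>j<n. r j u) \<le> 1" by (simp add: indicator_def)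
  next
    fix j assume j: "j < n"
    have "p j \<le> processed r j (s (Suc j))"
      using proc[OF j, of "s (Suc j)"] s_mono[of j "Suc j"] j by (simp add: s_def)
    thus "\<exists>u\<ge>0. p j \<le> processed r j u" using s_nn[of "Suc j"] j by auto
  qed (auto simp: r_def)
  thus ?thesis by blast
qed

lemma opt_lower_bound_le_OPT:
  assumes "\<And>j. j < n \<Longrightarrow> 0 < p j"
  shows "opt_lower_bound n p \<le> OPT n p"
  unfolding OPT_def
proof (rule cInf_greatest)
  show "{\<Sum>j<n. completion_time p r j | r. schedule n p r} \<noteq> {}"
    using schedule_exists[of n p] assms by blast
qed (use opt_lower_bound_le_schedule in blast)

section \<open>The cost of the algorithm\<close>

text \<open>The elapsed time at which job \<open>j\<close> becomes ready is \<open>a j\<close>. All unfinished jobs have the same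
  elapsed time, so the next job to be finished is one that minimises \<open>a\<close>. Job \<open>j\<close>, finished
  while \<open>m\<close> other jobs remain, delays each of them by \<open>p j\<close>, and each of them has delayed \<open>j\<close> by
  \<open>a j\<close>.\<close>

definition first_job :: "(nat set \<Rightarrow> nat) \<Rightarrow> (nat \<Rightarrow> real) \<Rightarrow> nat set \<Rightarrow> nat" where
  "first_job pick a J = pick {j \<in> J. \<forall>i\<in>J. a j \<le> a i}"

primrec etc_cost ::
    "(nat set \<Rightarrow> nat) \<Rightarrow> (nat \<Rightarrow> real) \<Rightarrow> (nat \<Rightarrow> real) \<Rightarrow> nat \<Rightarrow> nat set \<Rightarrow> real" where
  "etc_cost pick p a 0 J = 0"
| "etc_cost pick p a (Suc m) J = real (Suc m) * p (first_job pick a J) + real m * a (first_job pick a J)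
     + etc_cost pick p a m (J - {first_job pick a J})"

text \<open>If the job with the shorter processing time is ready first, the pair costs
  \<open>p + a\<close>. If the longer one is first, the true cost \<open>q + b\<close> is at most
  \<open>q + a\<close>, which is \<open>p + a\<close> plus \<open>q - p\<close>. Ties count as the
  bad case.\<close>

definition pair_cost :: "real \<Rightarrow> real \<Rightarrow> real \<Rightarrow> real \<Rightarrow> real" where
  "pair_cost p q a b =
     (if p \<le> q then p + a + (q - p) * of_bool (b \<le> a) else q + b + (p - q) * of_bool (a \<le> b))"

lemma first_job:
  assumes "\<And>S. S \<noteq> {} \<Longrightarrow> S \<subseteq> {..<n} \<Longrightarrow> pick S \<in> S" "J \<noteq> {}" "J \<subseteq> {..<n}"
  shows "first_job pick a J \<in> J" "i \<in> J \<Longrightarrow> a (first_job pick a J) \<le> a i"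
proof -
  have "finite J" using assms(3) by (rule finite_subset) simp
  then obtain j where "j \<in> J" "\<forall>i\<in>J. a j \<le> a i"
    using \<open>J \<noteq> {}\<close> ex_min_if_finite[of "a ` J"] by (force simp: not_less)
  hence "{j \<in> J. \<forall>i\<in>J. a j \<le> a i} \<noteq> {}" by blast
  hence "first_job pick a J \<in> {j \<in> J. \<forall>i\<in>J. a j \<le> a i}"
    unfolding first_job_def using assms by (intro assms(1)) auto
  thus "first_job pick a J \<in> J" "i \<in> J \<Longrightarrow> a (first_job pick a J) \<le> a i" by auto
qed

section \<open>One run of the algorithm in terms of the ready times\<close>

text \<open>Here \<open>b j\<close> is the fraction of job \<open>j\<close> at which its bar reaches
  the threshold. Since all unfinished jobs share the level \<open>l\<close>, Round-Robin lifts them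
  together to the smallest \<open>p j * b j\<close>.\<close>

lemma retc_step_eq:
  fixes b :: "nat \<Rightarrow> real"
  assumes pick: "\<And>S. S \<noteq> {} \<Longrightarrow> S \<subseteq> {..<n} \<Longrightarrow> pick S \<in> S"
    and p: "\<And>j. j < n \<Longrightarrow> 0 < p j"
    and ready: "\<And>j x. j < n \<Longrightarrow> 0 \<le> x \<Longrightarrow> \<theta> \<le> \<phi> j x \<longleftrightarrow> b j \<le> x"
    and J: "J \<noteq> {}" "J \<subseteq> {..<n}"
    and e: "\<And>i. i \<in> J \<Longrightarrow> e i = l" "0 \<le> l" "\<And>i. i \<in> J \<Longrightarrow> l \<le> p i * b i"
    and j: "j = first_job pick (\<lambda>j. p j * b j) J"
  obtains e' where
    "retc_step pick \<phi> p \<theta> (u, J, e, C) =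
      (u + real (card J) * (p j * b j - l) + (p j - p j * b j), J - {j}, e',
       C(j := u + real (card J) * (p j * b j - l) + (p j - p j * b j)))"
    "\<And>i. i \<in> J - {j} \<Longrightarrow> e' i = p j * b j"
proof -
  define a where "a i = p i * b i" for i
  define c where "c = real (card J)"
  have c: "0 < c" using J finite_subset[OF J(2)] by (auto simp: c_def card_gt_0_iff)
  have jJ: "j \<in> J" unfolding j using first_job(1)[OF pick J] .
  have j_min: "a j \<le> a i" if "i \<in> J" for i
    unfolding j a_def using first_job(2)[OF pick J that, where a = "\<lambda>j. p j * b j"] .
  have rr: "ready_jobs \<phi> p \<theta> J (round_robin J e d) = {i \<in> J. a i \<le> l + d / c}" if "0 \<le> d" for d
  proof -
    have "\<theta> \<le> \<phi> i ((l + d / c) / p i) \<longleftrightarrow> a i \<le> l + d / c" if "i \<in> J" for i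
    proof -
      have "i < n" "0 < p i" using that J p by auto
      moreover have "0 \<le> l + d / c" using \<open>0 \<le> d\<close> e c by simp
      ultimately show ?thesis by (subst ready) (auto simp: a_def field_simps)
    qed
    thus ?thesis using e unfolding ready_jobs_def round_robin_def c_def by auto
  qed
  \<comment> \<open>The durations after which some job is ready form a closed half-line, so the
    infimum is its end point.\<close>
  have "{d. 0 \<le> d \<and> ready_jobs \<phi> p \<theta> J (round_robin J e d) \<noteq> {}} = {c * (a j - l)..}"
  proof (intro set_eqI iffI)
    fix d assume "d \<in> {d. 0 \<le> d \<and> ready_jobs \<phi> p \<theta> J (round_robin J e d) \<noteq> {}}"
    then obtain i where "0 \<le> d" "i \<in> J" "a i \<le> l + d / c" using rr by auto
    hence "a j \<le> l + d / c" using j_min by fastforce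
    thus "d \<in> {c * (a j - l)..}" using c by (simp add: field_simps)
  next
    fix d assume "d \<in> {c * (a j - l)..}"
    hence d: "c * (a j - l) \<le> d" by simp
    moreover have "0 \<le> c * (a j - l)" using c e(3)[OF jJ] by (simp add: a_def)
    ultimately have "0 \<le> d" by linarith
    moreover have "a j \<le> l + d / c" using d c by (simp add: field_simps)
    ultimately show "d \<in> {d. 0 \<le> d \<and> ready_jobs \<phi> p \<theta> J (round_robin J e d) \<noteq> {}}"
      using rr jJ by auto
  qed
  hence dur: "explore_duration \<phi> p \<theta> J e = c * (a j - l)"
    unfolding explore_duration_def by simp
  have "0 \<le> c * (a j - l)" using c e(3)[OF jJ] by (simp add: a_def)
  \<comment> \<open>At that moment exactly the minimisers of \<open>a\<close> are ready, so
    \<open>pick\<close> receives the same set as in \<open>first_job\<close> and ties are resolved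
    alike.\<close>
  hence "ready_jobs \<phi> p \<theta> J (round_robin J e (c * (a j - l))) = {i \<in> J. \<forall>k\<in>J. a i \<le> a k}"
    using rr c j_min jJ by (auto intro: order_trans)
  hence pj: "pick (ready_jobs \<phi> p \<theta> J (round_robin J e (c * (a j - l)))) = j"
    unfolding j first_job_def a_def by simp
  have ej: "round_robin J e (c * (a j - l)) i = a j" if "i \<in> J" for i
    using that e c unfolding round_robin_def c_def by simp
  show ?thesis
  proof (rule that)
    show "retc_step pick \<phi> p \<theta> (u, J, e, C) =
      (u + real (card J) * (p j * b j - l) + (p j - p j * b j), J - {j},
       (round_robin J e (c * (a j - l)))(j := p j),
       C(j := u + real (card J) * (p j * b j - l) + (p j - p j * b j)))"
      using dur pj ej[OF jJ] by (simp add: Let_def a_def c_def)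
  qed (use ej in \<open>auto simp: a_def\<close>)
qed

text \<open>\<open>etc_cost\<close> counts exploration from level 0. Lifting \<open>m\<close> jobs
  to level \<open>l\<close> takes time \<open>m * l\<close> and delays all \<open>m\<close> of them,
  hence the correction \<open>m\<^sup>2 * l\<close>. The second conjunct keeps the recorded
  completion times through the induction.\<close>

lemma retc_iterate_cost:
  fixes b :: "nat \<Rightarrow> real"
  assumes pick: "\<And>S. S \<noteq> {} \<Longrightarrow> S \<subseteq> {..<n} \<Longrightarrow> pick S \<in> S"
    and p: "\<And>j. j < n \<Longrightarrow> 0 < p j"
    and ready: "\<And>j x. j < n \<Longrightarrow> 0 \<le> x \<Longrightarrow> \<theta> \<le> \<phi> j x \<longleftrightarrow> b j \<le> x"
    and J: "J \<subseteq> {..<n}" "card J = m"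
    and e: "\<And>i. i \<in> J \<Longrightarrow> e i = l" "0 \<le> l" "\<And>i. i \<in> J \<Longrightarrow> l \<le> p i * b i"
    and step: "(retc_step pick \<phi> p \<theta> ^^ m) (u, J, e, C) = (u', J', e', C')"
  shows "(\<Sum>j\<in>J. C' j) = real m * u + etc_cost pick p (\<lambda>j. p j * b j) m J - (real m)\<^sup>2 * l
    \<and> (\<forall>j. j \<notin> J \<longrightarrow> C' j = C j)"
  using J e step
proof (induction m arbitrary: J e l u C)
  case 0
  hence "J = {}" using finite_subset[of J "{..<n}"] by auto
  thus ?case using 0 by simp
next
  case (Suc m)
  define j where "j = first_job pick (\<lambda>j. p j * b j) J"
  define v where "v = u + real (card J) * (p j * b j - l) + (p j - p j * b j)"
  have fin: "finite J" using Suc.prems(1) by (rule finite_subset) simp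
  have Jne: "J \<noteq> {}" using Suc.prems(2) by auto
  note fj = first_job[OF pick Jne Suc.prems(1), where a = "\<lambda>j. p j * b j", folded j_def]
  obtain e2 where e2: "retc_step pick \<phi> p \<theta> (u, J, e, C) = (v, J - {j}, e2, C(j := v))"
    "\<And>i. i \<in> J - {j} \<Longrightarrow> e2 i = p j * b j"
  proof (rule retc_step_eq[OF pick p ready Jne Suc.prems(1,3,4,5) j_def, where u = u and C = C, folded v_def])
    fix e'
    assume "retc_step pick \<phi> p \<theta> (u, J, e, C) = (v, J - {j}, e', C(j := v))"
      and "\<And>i. i \<in> J - {j} \<Longrightarrow> e' i = p j * b j"
    thus thesis by (rule that)
  qed
  have "(retc_step pick \<phi> p \<theta> ^^ m) (v, J - {j}, e2, C(j := v)) = (u', J', e', C')"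
    using Suc.prems(6) by (simp only: funpow_Suc_right o_apply e2)
  moreover have "0 \<le> p j * b j" using Suc.prems(4,5) fj(1) by fastforce
  moreover have "card (J - {j}) = m" using Suc.prems(2) fj(1) fin by simp
  ultimately have IH: "(\<Sum>i\<in>J - {j}. C' i) = real m * v + etc_cost pick p (\<lambda>j. p j * b j) m (J - {j})
      - (real m)\<^sup>2 * (p j * b j)" "\<forall>i. i \<notin> J - {j} \<longrightarrow> C' i = (C(j := v)) i"
    using Suc.IH[of "J - {j}" e2 "p j * b j" v "C(j := v)"] Suc.prems(1) fj e2(2) by blast+
  have "(\<Sum>i\<in>J. C' i) = v + (\<Sum>i\<in>J - {j}. C' i)"
    using fj(1) fin IH(2) by (subst sum.remove[of _ j]) auto
  also have "\<dots> = real (Suc m) * u + etc_cost pick p (\<lambda>j. p j * b j) (Suc m) J - (real (Suc m))\<^sup>2 * l"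
    unfolding IH(1) etc_cost.simps j_def[symmetric] v_def Suc.prems(2)
    by (simp add: power2_eq_square algebra_simps)
  finally show ?case using IH(2) fj(1) by auto
qed

lemma retc_cost_eq:
  fixes b :: "nat \<Rightarrow> real"
  assumes pick: "\<And>S. S \<noteq> {} \<Longrightarrow> S \<subseteq> {..<n} \<Longrightarrow> pick S \<in> S"
    and p: "\<And>j. j < n \<Longrightarrow> 0 < p j"
    and ready: "\<And>j x. j < n \<Longrightarrow> 0 \<le> x \<Longrightarrow> \<theta> \<le> \<phi> j x \<longleftrightarrow> b j \<le> x"
    and b: "\<And>j. j < n \<Longrightarrow> 0 \<le> b j"
  shows "retc_cost pick \<phi> n p \<theta> = etc_cost pick p (\<lambda>j. p j * b j) n {..<n}"
proof -
  obtain u' J' e' C' where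
    step: "(retc_step pick \<phi> p \<theta> ^^ n) (0, {..<n}, \<lambda>_. 0, \<lambda>_. 0) = (u', J', e', C')"
    by (metis prod_cases4)
  have "0 \<le> p i * b i" if "i < n" for i using that p b by (simp add: less_imp_le)
  hence "(\<Sum>j<n. C' j) = etc_cost pick p (\<lambda>j. p j * b j) n {..<n}"
    using retc_iterate_cost[OF pick p ready _ _ _ _ _ step, where l = 0] by simp
  thus ?thesis unfolding retc_cost_def retc_completion_times_def step by simp
qed

section \<open>Charging the cost to pairs of jobs\<close>

text \<open>Pairs are ordered by index but jobs leave in the order of \<open>a\<close>, so the pairs
  containing \<open>j\<close> appear with \<open>min\<close> and \<open>max\<close>.\<close>

lemma sum_pairs_remove:
  fixes f :: "nat \<Rightarrow> nat \<Rightarrow> 'a :: comm_monoid_add"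
  assumes "finite J" "j \<in> J"
  shows "(\<Sum>(i, k)\<in>{(i, k). i < k \<and> i \<in> J \<and> k \<in> J}. f i k)
    = (\<Sum>(i, k)\<in>{(i, k). i < k \<and> i \<in> J - {j} \<and> k \<in> J - {j}}. f i k)
      + (\<Sum>i\<in>J - {j}. f (min i j) (max i j))"
proof -
  have fin: "finite {(i, k). i < k \<and> i \<in> J - {j} \<and> k \<in> J - {j}}"
    by (rule finite_subset[of _ "J \<times> J"]) (use assms in auto)
  have "{(i, k). i < k \<and> i \<in> J \<and> k \<in> J} =
      {(i, k). i < k \<and> i \<in> J - {j} \<and> k \<in> J - {j}} \<union> (\<lambda>i. (min i j, max i j)) ` (J - {j})"
    (is "?L = ?A \<union> ?B")
  proof (intro set_eqI iffI)
    fix x assume "x \<in> ?L"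
    then obtain i k where x: "x = (i, k)" "i < k" "i \<in> J" "k \<in> J" by auto
    consider "i = j" | "k = j" | "i \<noteq> j" "k \<noteq> j" by blast
    thus "x \<in> ?A \<union> ?B"
    proof cases
      case 1
      hence "x = (min k j, max k j)" "k \<in> J - {j}" using x by auto
      thus ?thesis by blast
    next
      case 2
      hence "x = (min i j, max i j)" "i \<in> J - {j}" using x by auto
      thus ?thesis by blast
    qed (use x in auto)
  qed (use assms in \<open>auto simp: min_def max_def\<close>)
  moreover have "?A \<inter> ?B = {}" by (auto simp: min_def max_def split: if_splits)
  moreover have "inj_on (\<lambda>i. (min i j, max i j)) (J - {j})"
    by (auto simp: inj_on_def min_def max_def split: if_splits)
  ultimately show ?thesis using fin assms
    by (simp add: sum.union_disjoint sum.reindex)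
qed

text \<open>If the first finisher is the longer job, the indicator is 1 and replaces the shorter
  processing time by the longer one; what remains is \<open>p + b\<close>, at least
  \<open>p + a\<close>.\<close>

lemma pair_cost_ge:
  assumes "a \<le> b"
  shows "p + a \<le> pair_cost p q a b" "p + a \<le> pair_cost q p b a"
proof -
  have "0 \<le> (q - p) * of_bool (b \<le> a)" if "p \<le> q" using that by simp
  thus "p + a \<le> pair_cost p q a b" "p + a \<le> pair_cost q p b a"
    using assms unfolding pair_cost_def by (auto simp: not_le)
qed

text \<open>The job finished first accounts for \<open>p j + a j\<close> with each of the
  \<open>m\<close> others, which \<open>pair_cost\<close> dominates pair by pair.\<close>

lemma etc_cost_le:
  assumes pick: "\<And>S. S \<noteq> {} \<Longrightarrow> S \<subseteq> {..<n} \<Longrightarrow> pick S \<in> S"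
    and "J \<subseteq> {..<n}" "card J = m"
  shows "etc_cost pick p a m J \<le> (\<Sum>j\<in>J. p j)
    + (\<Sum>(i, j)\<in>{(i, j). i < j \<and> i \<in> J \<and> j \<in> J}. pair_cost (p i) (p j) (a i) (a j))"
  using assms(2,3)
proof (induction m arbitrary: J)
  case 0
  hence "J = {}" using finite_subset[of J "{..<n}"] by auto
  thus ?case by simp
next
  case (Suc m)
  define j where "j = first_job pick a J"
  have fin: "finite J" using Suc.prems(1) by (rule finite_subset) simp
  have Jne: "J \<noteq> {}" using Suc.prems(2) by auto
  note fj = first_job[OF pick Jne Suc.prems(1), where a = a, folded j_def]
  have card: "card (J - {j}) = m" using Suc.prems(2) fj(1) fin by simp
  have "real m * (p j + a j) = (\<Sum>i\<in>J - {j}. p j + a j)" by (simp add: card)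
  also have "\<dots> \<le> (\<Sum>i\<in>J - {j}. pair_cost (p (min i j)) (p (max i j)) (a (min i j)) (a (max i j)))"
    using fj by (intro sum_mono) (auto simp: min_def max_def intro!: pair_cost_ge)
  finally have "real m * (p j + a j)
    \<le> (\<Sum>i\<in>J - {j}. pair_cost (p (min i j)) (p (max i j)) (a (min i j)) (a (max i j)))" .
  moreover have "etc_cost pick p a m (J - {j}) \<le> (\<Sum>j\<in>J - {j}. p j)
    + (\<Sum>(i, k)\<in>{(i, k). i < k \<and> i \<in> J - {j} \<and> k \<in> J - {j}}. pair_cost (p i) (p k) (a i) (a k))"
    using Suc.prems(1) card by (intro Suc.IH) auto
  moreover have "(\<Sum>j\<in>J. p j) = p j + (\<Sum>j\<in>J - {j}. p j)"
    using fin fj(1) by (rule sum.remove)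
  moreover have "real (Suc m) * p j + real m * a j = p j + real m * (p j + a j)"
    by (simp add: algebra_simps)
  ultimately show ?case
    using sum_pairs_remove[OF fin fj(1), of "\<lambda>i k. pair_cost (p i) (p k) (a i) (a k)"]
    unfolding etc_cost.simps j_def[symmetric] by linarith
qed

lemma etc_cost_nonneg:
  assumes pick: "\<And>S. S \<noteq> {} \<Longrightarrow> S \<subseteq> {..<n} \<Longrightarrow> pick S \<in> S"
    and "J \<subseteq> {..<n}" "card J = m" "\<And>j. j < n \<Longrightarrow> 0 \<le> p j" "\<And>j. j < n \<Longrightarrow> 0 \<le> a j"
  shows "0 \<le> etc_cost pick p a m J"
  using assms(2,3)
proof (induction m arbitrary: J)
  case (Suc m)
  have fin: "finite J" using Suc.prems(1) by (rule finite_subset) simp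
  have "J \<noteq> {}" using Suc.prems(2) by auto
  note fj = first_job(1)[OF pick this Suc.prems(1), of a]
  have "0 \<le> etc_cost pick p a m (J - {first_job pick a J})"
    using Suc.prems fj fin by (intro Suc.IH) auto
  moreover have "first_job pick a J < n" using fj Suc.prems(1) by auto
  ultimately show ?case using assms(4,5) by simp
qed simp

text \<open>The set of minimisers takes finitely many values, so composing it with an arbitrary
  \<open>pick\<close> stays measurable.\<close>

lemma measurable_etc_cost:
  fixes a :: "'w \<Rightarrow> nat \<Rightarrow> real"
  assumes pick: "\<And>S. S \<noteq> {} \<Longrightarrow> S \<subseteq> {..<n} \<Longrightarrow> pick S \<in> S"
    and "J \<subseteq> {..<n}" "card J = m"
    and a: "\<And>j. j < n \<Longrightarrow> (\<lambda>\<omega>. a \<omega> j) \<in> borel_measurable M"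
  shows "(\<lambda>\<omega>. etc_cost pick p (a \<omega>) m J) \<in> borel_measurable M"
  using assms(2,3)
proof (induction m arbitrary: J)
  case (Suc m)
  have fin: "finite J" using Suc.prems(1) by (rule finite_subset) simp
  have Jne: "J \<noteq> {}" using Suc.prems(2) by auto
  note fj = first_job(1)[OF pick Jne Suc.prems(1)]
  have am [measurable]: "(\<lambda>\<omega>. a \<omega> j) \<in> borel_measurable M" if "j \<in> J" for j
    using a Suc.prems(1) that by auto
  have "(\<lambda>\<omega>. {j \<in> J. \<forall>i\<in>J. a \<omega> j \<le> a \<omega> i}) \<in> M \<rightarrow>\<^sub>M count_space (Pow J)"
  proof (subst measurable_count_space_eq2)
    have "(\<lambda>\<omega>. {j \<in> J. \<forall>i\<in>J. a \<omega> j \<le> a \<omega> i}) -` {S} \<inter> space M \<in> sets M" if "S \<subseteq> J" for S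
    proof -
      have "(\<lambda>\<omega>. {j \<in> J. \<forall>i\<in>J. a \<omega> j \<le> a \<omega> i}) -` {S} \<inter> space M =
          {\<omega> \<in> space M. \<forall>j\<in>J. (\<forall>i\<in>J. a \<omega> j \<le> a \<omega> i) \<longleftrightarrow> j \<in> S}"
        using that by auto
      also have "\<dots> \<in> sets M" using fin by measurable
      finally show ?thesis .
    qed
    thus "(\<lambda>\<omega>. {j \<in> J. \<forall>i\<in>J. a \<omega> j \<le> a \<omega> i}) \<in> space M \<rightarrow> Pow J \<and>
      (\<forall>S\<in>Pow J. (\<lambda>\<omega>. {j \<in> J. \<forall>i\<in>J. a \<omega> j \<le> a \<omega> i}) -` {S} \<inter> space M \<in> sets M)" by auto
  qed (use fin in simp)
  hence "(\<lambda>\<omega>. first_job pick (a \<omega>) J) \<in> M \<rightarrow>\<^sub>M count_space UNIV"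
    unfolding first_job_def by (rule measurable_compose) simp
  hence F: "(\<lambda>\<omega>. first_job pick (a \<omega>) J) \<in> M \<rightarrow>\<^sub>M count_space J"
    using fj by (intro measurable_count_space_extend[of J UNIV]) auto
  \<comment> \<open>The recursion is split over the finitely many values of the first job, so that
    the induction hypothesis meets a fixed set.\<close>
  have "(\<lambda>\<omega>. (\<lambda>j \<omega>. real (Suc m) * p j + real m * a \<omega> j + etc_cost pick p (a \<omega>) m (J - {j}))
      (first_job pick (a \<omega>) J) \<omega>) \<in> borel_measurable M"
  proof (rule measurable_compose_countable'[OF _ F])
    fix j assume j: "j \<in> J"
    have [measurable]: "(\<lambda>\<omega>. etc_cost pick p (a \<omega>) m (J - {j})) \<in> borel_measurable M"
      using Suc.prems j fin by (intro Suc.IH) auto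
    show "(\<lambda>\<omega>. real (Suc m) * p j + real m * a \<omega> j + etc_cost pick p (a \<omega>) m (J - {j})) \<in> borel_measurable M"
      using j by measurable
  qed (use fin in \<open>simp add: countable_finite\<close>)
  thus ?case by simp
qed simp

section \<open>Where a progress bar reaches the threshold\<close>

text \<open>An infimum makes sense for unsorted \<open>t\<close> too, so the cost identity holds at
  every outcome and sortedness is used only almost everywhere.\<close>

definition ready_point :: "nat \<Rightarrow> nat \<Rightarrow> (nat \<Rightarrow> real) \<Rightarrow> real" where
  "ready_point g k t = Inf {x. 0 \<le> x \<and> real k / (real g + 1) \<le> progress_bar g t x}"

lemma threshold_le_progress_bar_iff:
  "real k / (real g + 1) \<le> progress_bar g t x \<longleftrightarrow> k \<le> card {h \<in> {1..g + 1}. bar_jump g t h \<le> x}"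
proof -
  have "(\<Sum>h = 1..g + 1. of_bool (bar_jump g t h \<le> x))
      = real (card ({1..g + 1} \<inter> {h. bar_jump g t h \<le> x}))"
    by (subst sum_of_bool_eq) (rule finite_atLeastAtMost, rule refl)
  moreover have "{1..g + 1} \<inter> {h. bar_jump g t h \<le> x} = {h \<in> {1..g + 1}. bar_jump g t h \<le> x}" by auto
  ultimately show ?thesis
    unfolding progress_bar_def by (simp only: divide_le_cancel) (simp add: of_nat_le_iff)
qed

text \<open>The threshold is reached at \<open>x\<close> iff some \<open>k\<close> of the jumps lie
  at or below \<open>x\<close>. This writes the set as a finite union of closed sets, so the infimum
  is attained; it is at most 1 as every jump is.\<close>

lemma ready_point:
  assumes "k \<le> g + 1"
  shows "0 \<le> ready_point g k t" "ready_point g k t \<le> 1"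
    "0 \<le> x \<Longrightarrow> real k / (real g + 1) \<le> progress_bar g t x \<longleftrightarrow> ready_point g k t \<le> x"
proof -
  let ?N = "\<lambda>x. {h \<in> {1..g + 1}. bar_jump g t h \<le> x}"
  define S where "S = {x. 0 \<le> x \<and> k \<le> card (?N x)}"
  have rp: "ready_point g k t = Inf S"
    unfolding ready_point_def threshold_le_progress_bar_iff S_def ..
  have "?N 1 = {1..g + 1}" by (auto simp: bar_jump_def)
  hence S1: "1 \<in> S" using assms by (simp add: S_def)
  have bdd: "bdd_below S" by (intro bdd_belowI[of _ 0]) (simp add: S_def)
  have "S = {0..} \<inter> (\<Union>A\<in>{A. A \<subseteq> {1..g + 1} \<and> card A = k}. \<Inter>h\<in>A. {bar_jump g t h..})"
  proof (intro set_eqI iffI)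
    fix x assume "x \<in> S"
    then obtain A where "A \<subseteq> ?N x" "card A = k" "0 \<le> x"
      unfolding S_def using obtain_subset_with_card_n by blast
    thus "x \<in> {0..} \<inter> (\<Union>A\<in>{A. A \<subseteq> {1..g + 1} \<and> card A = k}. \<Inter>h\<in>A. {bar_jump g t h..})"
      by (auto intro!: exI[of _ A])
  next
    fix x assume "x \<in> {0..} \<inter> (\<Union>A\<in>{A. A \<subseteq> {1..g + 1} \<and> card A = k}. \<Inter>h\<in>A. {bar_jump g t h..})"
    then obtain A where A: "0 \<le> x" "A \<subseteq> {1..g + 1}" "card A = k" "\<forall>h\<in>A. bar_jump g t h \<le> x" by auto
    hence "card A \<le> card (?N x)" by (intro card_mono) auto
    thus "x \<in> S" using A by (simp add: S_def)
  qed
  moreover have "closed ({0..} \<inter> (\<Union>A\<in>{A. A \<subseteq> {1..g + 1} \<and> card A = k}. \<Inter>h\<in>A. {bar_jump g t h..}))"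
    by (intro closed_Int closed_UN closed_INT ballI closed_atLeast finite_subset[of "{A. A \<subseteq> {1..g + 1} \<and> card A = k}" "Pow {1..g + 1}"]) auto
  ultimately have "closed S" by simp
  hence inS: "Inf S \<in> S" using S1 bdd by (intro closed_contains_Inf) auto
  show "0 \<le> ready_point g k t" using inS by (simp add: rp S_def)
  show "ready_point g k t \<le> 1" unfolding rp using S1 bdd by (rule cInf_lower)
  show "real k / (real g + 1) \<le> progress_bar g t x \<longleftrightarrow> ready_point g k t \<le> x" if "0 \<le> x"
    unfolding threshold_le_progress_bar_iff rp
  proof
    assume "k \<le> card (?N x)"
    thus "Inf S \<le> x" using that bdd by (intro cInf_lower) (auto simp: S_def)
  next
    assume "Inf S \<le> x"
    hence "card (?N (Inf S)) \<le> card (?N x)" by (intro card_mono) auto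
    thus "k \<le> card (?N x)" using inS by (simp add: S_def)
  qed
qed

text \<open>In sorted order at least \<open>k\<close> jumps lie at or below \<open>x\<close> iff the
  \<open>k\<close>-th does. As \<open>k \<le> g\<close>, that jump is a truncated point, with index
  \<open>k - 1\<close> because \<open>t\<close> starts at 0.\<close>

lemma ready_point_incseq:
  assumes "1 \<le> k" "k \<le> g" "incseq t" "0 \<le> t 0"
  shows "ready_point g k t = min 1 (t (k - 1))"
proof -
  have mono: "bar_jump g t h \<le> bar_jump g t h'" if "1 \<le> h" "h \<le> h'" for h h'
  proof -
    have "t (h - 1) \<le> t (h' - 1)" using that by (intro incseqD[OF assms(3)]) simp
    thus ?thesis using that by (auto simp: bar_jump_def)
  qed
  have "k \<le> card {h \<in> {1..g + 1}. bar_jump g t h \<le> x} \<longleftrightarrow> bar_jump g t k \<le> x" for x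
  proof
    assume k: "k \<le> card {h \<in> {1..g + 1}. bar_jump g t h \<le> x}"
    show "bar_jump g t k \<le> x"
    proof (rule ccontr)
      assume x: "\<not> bar_jump g t k \<le> x"
      have "{h \<in> {1..g + 1}. bar_jump g t h \<le> x} \<subseteq> {1..<k}"
      proof (intro subsetI, rule ccontr)
        fix h assume h: "h \<in> {h \<in> {1..g + 1}. bar_jump g t h \<le> x}" "h \<notin> {1..<k}"
        hence "bar_jump g t k \<le> bar_jump g t h" using assms(1) by (intro mono) auto
        with h x show False by auto
      qed
      hence "card {h \<in> {1..g + 1}. bar_jump g t h \<le> x} \<le> card {1..<k}" by (intro card_mono) auto
      with k assms(1) show False by simp
    qed
  next
    assume x: "bar_jump g t k \<le> x"
    have "{1..k} \<subseteq> {h \<in> {1..g + 1}. bar_jump g t h \<le> x}"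
    proof
      fix h assume "h \<in> {1..k}"
      with mono[of h k] x assms(2) show "h \<in> {h \<in> {1..g + 1}. bar_jump g t h \<le> x}" by auto
    qed
    hence "card {1..k} \<le> card {h \<in> {1..g + 1}. bar_jump g t h \<le> x}" by (intro card_mono) auto
    thus "k \<le> card {h \<in> {1..g + 1}. bar_jump g t h \<le> x}" by simp
  qed
  moreover have "0 \<le> t (k - 1)" using assms(4) incseqD[OF assms(3), of 0 "k - 1"] by simp
  ultimately have "{x. 0 \<le> x \<and> real k / (real g + 1) \<le> progress_bar g t x} = {min 1 (t (k - 1))..}"
    using assms(2) by (auto simp: threshold_le_progress_bar_iff bar_jump_def)
  thus ?thesis unfolding ready_point_def by simp
qed

text \<open>A sublevel set at \<open>x\<close> is an event about the displayed progress at the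
  single position \<open>x\<close>.\<close>

lemma measurable_ready_point:
  assumes "k \<le> g + 1" and t: "\<And>i. (\<lambda>\<omega>. t \<omega> i) \<in> borel_measurable M"
  shows "(\<lambda>\<omega>. ready_point g k (t \<omega>)) \<in> borel_measurable M"
proof (rule borel_measurableI_le)
  fix x
  note [measurable] = t
  show "{\<omega> \<in> space M. ready_point g k (t \<omega>) \<le> x} \<in> sets M"
  proof (cases "0 \<le> x")
    case True
    have "{\<omega> \<in> space M. ready_point g k (t \<omega>) \<le> x}
        = {\<omega> \<in> space M. real k / (real g + 1) \<le> progress_bar g (t \<omega>) x}"
      using ready_point(3)[OF assms(1) True] by auto
    also have "\<dots> \<in> sets M" unfolding progress_bar_def bar_jump_def by measurable
    finally show ?thesis .
  next
    case False
    hence "{\<omega> \<in> space M. ready_point g k (t \<omega>) \<le> x} = {}"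
      by (auto dest: order_trans[OF ready_point(1)[OF assms(1)]])
    thus ?thesis by (simp only: sets.empty_sets)
  qed
qed

section \<open>Erlang variables and Poisson processes\<close>

lemma poisson_point_process_AE:
  assumes "poisson_point_process M r T"
  shows "AE \<omega> in M. incseq (\<lambda>i. T i \<omega>) \<and> 0 \<le> T 0 \<omega>"
proof -
  have "AE \<omega> in M. (\<forall>i. 0 \<le> T i \<omega> \<and> T i \<omega> \<le> T (Suc i) \<omega>) \<and> filterlim (\<lambda>i. T i \<omega>) at_top sequentially"
    using assms unfolding poisson_point_process_def by blast
  thus ?thesis by eventually_elim (auto intro: incseq_SucI)
qed

text \<open>Duality between points and counts. Divergence gives a first index \<open>c\<close>
  beyond \<open>a\<close>, so the count is finite and equals \<open>c\<close>.\<close>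

lemma le_iff_less_num_points:
  assumes "incseq (\<lambda>i. T i \<omega>)" "0 \<le> T 0 \<omega>" "filterlim (\<lambda>i. T i \<omega>) at_top sequentially"
  shows "T m \<omega> \<le> a \<longleftrightarrow> m < num_points T {0..a} \<omega>"
proof -
  have "eventually (\<lambda>i. a < T i \<omega>) sequentially"
    using assms(3) by (auto simp: filterlim_at_top_dense)
  then obtain N where N: "\<And>i. N \<le> i \<Longrightarrow> a < T i \<omega>" unfolding eventually_sequentially by blast
  define c where "c = (LEAST i. a < T i \<omega>)"
  have c: "a < T c \<omega>" unfolding c_def by (rule LeastI[of _ N]) (use N in simp)
  have iff: "T i \<omega> \<le> a \<longleftrightarrow> i < c" for i
  proof
    assume "T i \<omega> \<le> a"
    thus "i < c" using c incseqD[OF assms(1), of c i] by (cases "i < c") auto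
  next
    assume "i < c"
    thus "T i \<omega> \<le> a" unfolding c_def using not_less_Least by fastforce
  qed
  have "0 \<le> T i \<omega>" for i using assms(2) incseqD[OF assms(1), of 0 i] by simp
  hence "{i. T i \<omega> \<in> {0..a}} = {..<c}" using iff by auto
  thus ?thesis unfolding num_points_def iff by simp
qed

text \<open>By this duality the distribution function is one minus a Poisson sum. Both indices start
  at 0: \<open>T m\<close> is point number \<open>m + 1\<close> and \<open>erlang_density m\<close>
  has shape \<open>m + 1\<close>.\<close>

lemma (in prob_space) poisson_point_erlang:
  assumes P: "poisson_point_process M r T" and r: "0 < r"
  shows "distributed M lborel (T m) (erlang_density m r)"
proof (subst erlang_distributed_iff[OF r], intro conjI allI impI r)
  show Tm: "T m \<in> borel_measurable M" using P unfolding poisson_point_process_def by blast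
  fix a :: real assume a: "0 \<le> a"
  define N where "N = num_points T {0..a}"
  have prob: "prob {\<omega> \<in> space M. N \<omega> = i} = exp (- (r * a)) * (r * a) ^ i / fact i" for i
  proof -
    have "prob {\<omega> \<in> space M. num_points T {0..a} \<omega> = i}
        = exp (- (r * measure lborel {0..a})) * (r * measure lborel {0..a}) ^ i / fact i"
      using P unfolding poisson_point_process_def by auto
    thus ?thesis using a by (simp add: N_def)
  qed
  \<comment> \<open>Measurability of the count is part of \<open>indep_vars\<close>, taken here for
    a one-element family.\<close>
  have "indep_vars (\<lambda>_. count_space UNIV) (num_points T) {{0..a}}"
    using P unfolding poisson_point_process_def by (auto simp: disjoint_def)
  hence [measurable]: "N \<in> M \<rightarrow>\<^sub>M count_space UNIV"
    unfolding indep_vars_def N_def by auto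
  have AEeq: "AE \<omega> in M. T m \<omega> \<le> a \<longleftrightarrow> m < N \<omega>"
  proof -
    have "AE \<omega> in M. (\<forall>i. 0 \<le> T i \<omega> \<and> T i \<omega> \<le> T (Suc i) \<omega>) \<and> filterlim (\<lambda>i. T i \<omega>) at_top sequentially"
      using P unfolding poisson_point_process_def by blast
    thus ?thesis
      unfolding N_def by eventually_elim (rule le_iff_less_num_points, auto intro: incseq_SucI)
  qed
  have "prob {\<omega> \<in> space M. T m \<omega> \<le> a} = prob {\<omega> \<in> space M. m < N \<omega>}"
    using AEeq Tm by (intro finite_measure_eq_AE) auto
  also have "{\<omega> \<in> space M. m < N \<omega>} = space M - {\<omega> \<in> space M. N \<omega> \<le> m}" by auto
  also have "prob \<dots> = 1 - prob {\<omega> \<in> space M. N \<omega> \<le> m}" by (intro prob_compl) measurable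
  also have "{\<omega> \<in> space M. N \<omega> \<le> m} = (\<Union>i\<le>m. {\<omega> \<in> space M. N \<omega> = i})" by auto
  also have "prob \<dots> = (\<Sum>i\<le>m. prob {\<omega> \<in> space M. N \<omega> = i})"
    by (intro finite_measure_finite_Union) (auto simp: disjoint_family_on_def)
  finally show "prob {\<omega> \<in> space M. T m \<omega> \<le> a} = erlang_CDF m r a"
    unfolding prob erlang_CDF_def using a by (simp add: mult.commute)
qed

text \<open>Exponential tilting: times \<open>exp (s * x)\<close>, the density of rate
  \<open>l\<close> is a multiple of the density of rate \<open>l - s\<close>. Negative
  \<open>s\<close> is allowed, as the Chernoff bound requires.\<close>

lemma (in prob_space) has_bochner_integral_erlang_exp:
  assumes D: "distributed M lborel X (erlang_density m l)" and l: "0 < l" and s: "s < l"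
  shows "has_bochner_integral M (\<lambda>\<omega>. exp (s * X \<omega>)) ((l / (l - s)) ^ Suc m)"
proof (rule has_bochner_integral_nn_integral)
  have [measurable]: "X \<in> borel_measurable M" using distributed_measurable[OF D] by simp
  show "(\<lambda>\<omega>. exp (s * X \<omega>)) \<in> borel_measurable M" by measurable
  have eq: "erlang_density m l x * exp (s * x) = (l / (l - s)) ^ Suc m * erlang_density m (l - s) x" for x
  proof -
    have "exp (- (l - s) * x) = exp (- l * x) * exp (s * x)"
      by (simp add: algebra_simps flip: exp_add)
    thus ?thesis using s by (simp add: erlang_density_def power_divide)
  qed
  have "(\<integral>\<^sup>+\<omega>. ennreal (exp (s * X \<omega>)) \<partial>M) = (\<integral>\<^sup>+x. ennreal (erlang_density m l x) * ennreal (exp (s * x)) \<partial>lborel)"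
    by (rule distributed_nn_integral[OF D, symmetric]) measurable
  also have "\<dots> = (\<integral>\<^sup>+x. ennreal ((l / (l - s)) ^ Suc m) * ennreal (erlang_density m (l - s) x) \<partial>lborel)"
  proof (intro nn_integral_cong)
    fix x
    have "ennreal (erlang_density m l x) * ennreal (exp (s * x)) = ennreal (erlang_density m l x * exp (s * x))"
      using l by (intro ennreal_mult [symmetric]) auto
    also have "\<dots> = ennreal ((l / (l - s)) ^ Suc m) * ennreal (erlang_density m (l - s) x)"
      unfolding eq using l s by (intro ennreal_mult) auto
    finally show "ennreal (erlang_density m l x) * ennreal (exp (s * x)) = \<dots>" .
  qed
  also have "\<dots> = ennreal ((l / (l - s)) ^ Suc m) * (\<integral>\<^sup>+x. ennreal (erlang_density m (l - s) x) \<partial>lborel)"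
    by (rule nn_integral_cmult) measurable
  also have "(\<integral>\<^sup>+x. ennreal (erlang_density m (l - s) x) \<partial>lborel) = 1"
    using nn_integral_erlang_ith_moment[of "l - s" m 0] s by simp
  finally show "(\<integral>\<^sup>+\<omega>. ennreal (exp (s * X \<omega>)) \<partial>M) = ennreal ((l / (l - s)) ^ Suc m)" by simp
qed (use l s in auto)

text \<open>Chernoff bound: the indicator is at most \<open>exp (s * (X - x * Y))\<close>, whose
  expectation factors by independence.\<close>

lemma (in prob_space) erlang_ratio_tail:
  assumes X: "distributed M lborel X (erlang_density m l)"
    and Y: "distributed M lborel Y (erlang_density m l)"
    and indep: "indep_var borel X borel Y" and l: "0 < l" and x: "1 < x"
  shows "prob {\<omega> \<in> space M. x * Y \<omega> \<le> X \<omega>} \<le> (4 * x / (x + 1)\<^sup>2) ^ Suc m"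
proof -
  have [measurable]: "X \<in> borel_measurable M" "Y \<in> borel_measurable M"
    using distributed_measurable[OF X] distributed_measurable[OF Y] by simp_all
  \<comment> \<open>the minimiser of the moment generating function of \<open>X - x * Y\<close>\<close>
  define s where "s = l * (x - 1) / (2 * x)"
  have ls: "l - s = l * (x + 1) / (2 * x)" "l + s * x = l * (x + 1) / 2"
    using x by (simp_all add: s_def field_simps)
  have s: "0 < s" using x l by (simp add: s_def)
  have sl: "s < l"
  proof -
    have "0 < l - s" unfolding ls using x l by simp
    thus ?thesis by simp
  qed
  have sx: "- (s * x) < l" using s x l mult_pos_pos[of s x] by linarith
  note EX = has_bochner_integral_erlang_exp[OF X l sl]
  note EY = has_bochner_integral_erlang_exp[OF Y l sx]
  have "indep_var borel ((\<lambda>z. exp (s * z)) \<circ> X) borel ((\<lambda>z. exp (- (s * x) * z)) \<circ> Y)"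
    by (rule indep_var_compose[OF indep]) measurable
  hence ind: "indep_var borel (\<lambda>\<omega>. exp (s * X \<omega>)) borel (\<lambda>\<omega>. exp (- (s * x) * Y \<omega>))"
    by (simp add: o_def)
  note iX = integrable.intros[OF EX] and iY = integrable.intros[OF EY]
  have "prob {\<omega> \<in> space M. x * Y \<omega> \<le> X \<omega>} = expectation (indicator {\<omega> \<in> space M. x * Y \<omega> \<le> X \<omega>})"
    by simp
  also have "\<dots> \<le> expectation (\<lambda>\<omega>. exp (s * X \<omega>) * exp (- (s * x) * Y \<omega>))"
  proof (rule integral_mono)
    show "integrable M (\<lambda>\<omega>. exp (s * X \<omega>) * exp (- (s * x) * Y \<omega>))"
      by (rule indep_var_integrable[OF ind iX iY])
    show "integrable M (indicat_real {\<omega> \<in> space M. x * Y \<omega> \<le> X \<omega>})"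
      by (intro integrable_real_indicator) (auto simp: emeasure_eq_measure)
    fix \<omega> assume "\<omega> \<in> space M"
    have "1 \<le> exp (s * X \<omega>) * exp (- (s * x) * Y \<omega>)" if "x * Y \<omega> \<le> X \<omega>"
    proof -
      have "0 \<le> s * (X \<omega> - x * Y \<omega>)" using s that by simp
      hence "1 \<le> exp (s * (X \<omega> - x * Y \<omega>))" by simp
      also have "\<dots> = exp (s * X \<omega>) * exp (- (s * x) * Y \<omega>)"
        by (simp add: algebra_simps flip: exp_add)
      finally show ?thesis .
    qed
    thus "indicator {\<omega> \<in> space M. x * Y \<omega> \<le> X \<omega>} \<omega> \<le> exp (s * X \<omega>) * exp (- (s * x) * Y \<omega>)"
      by (auto simp: indicator_def)
  qed
  also have "\<dots> = (l / (l - s)) ^ Suc m * (l / (l - - (s * x))) ^ Suc m"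
    unfolding indep_var_lebesgue_integral[OF ind iX iY]
    by (simp only: has_bochner_integral_integral_eq[OF EX] has_bochner_integral_integral_eq[OF EY])
  also have "\<dots> = ((l / (l - s)) * (l / (l + s * x))) ^ Suc m"
    by (simp only: power_mult_distrib diff_minus_eq_add)
  also have "(l / (l - s)) * (l / (l + s * x)) = 4 * x / (x + 1)\<^sup>2"
  proof -
    have "l / (l - s) = 2 * x / (x + 1)" "l / (l + s * x) = 2 / (x + 1)"
      unfolding ls using l x by simp_all
    thus ?thesis by (simp add: power2_eq_square)
  qed
  finally show ?thesis .
qed

lemma (in prob_space) indep_vars_indep_var:
  fixes X :: "'i \<Rightarrow> 'a \<Rightarrow> real"
  assumes "indep_vars (\<lambda>_. borel) X I" "i \<in> I" "j \<in> I" "i \<noteq> j"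
  shows "indep_var borel (X i) borel (X j)"
proof -
  have "indep_vars (\<lambda>_. borel) X {i, j}" by (rule indep_vars_subset[OF assms(1)]) (use assms in auto)
  \<comment> \<open>A sum over the singleton \<open>{j}\<close> is \<open>X j\<close>
    itself.\<close>
  thus ?thesis using indep_vars_sum[of "{j}" i X] assms(4) by simp
qed

section \<open>The expected cost\<close>

text \<open>Truncation at 1 only helps: it lowers the mean of \<open>X\<close>, and for
  \<open>p < q\<close> the event that the longer job is ready first lies almost surely in the event
  \<open>x * Y \<le> X\<close> with \<open>x = q / p\<close>.\<close>

lemma (in prob_space) expectation_pair_cost_aux:
  fixes X Y b b' :: "'a \<Rightarrow> real" and p q \<epsilon> :: real
  assumes X: "distributed M lborel X (erlang_density m l)"
    and Y: "distributed M lborel Y (erlang_density m l)"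
    and indep: "indep_var borel X borel Y" and l: "0 < l"
    and meas [measurable]: "b \<in> borel_measurable M" "b' \<in> borel_measurable M"
    and bounds: "\<And>\<omega>. 0 \<le> b \<omega>" "\<And>\<omega>. b \<omega> \<le> 1"
    and b: "AE \<omega> in M. b \<omega> = min 1 (X \<omega>)" and b': "AE \<omega> in M. b' \<omega> = min 1 (Y \<omega>)"
    and pq: "0 < p" "p \<le> q"
    and ratio: "\<And>x. 1 < x \<Longrightarrow> (x - 1) * (4 * x / (x + 1)\<^sup>2) ^ Suc m + (real m + 1) / l \<le> \<epsilon>"
  shows "integrable M (\<lambda>\<omega>. p + p * b \<omega> + (q - p) * of_bool (q * b' \<omega> \<le> p * b \<omega>))" (is ?int)
    and "(\<integral>\<omega>. p + p * b \<omega> + (q - p) * of_bool (q * b' \<omega> \<le> p * b \<omega>) \<partial>M) \<le> (1 + \<epsilon>) * p" (is ?le)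
proof -
  define A where "A = {\<omega> \<in> space M. q * b' \<omega> \<le> p * b \<omega>}"
  have [measurable]: "A \<in> sets M" unfolding A_def by measurable
  have [measurable]: "X \<in> borel_measurable M" "Y \<in> borel_measurable M"
    using distributed_measurable[OF X] distributed_measurable[OF Y] by simp_all
  have ind: "of_bool (q * b' \<omega> \<le> p * b \<omega>) = indicat_real A \<omega>" if "\<omega> \<in> space M" for \<omega>
    using that by (simp add: A_def indicator_def)
  have int_A: "integrable M (indicat_real A)"
    by (intro integrable_real_indicator) (auto simp: emeasure_eq_measure)
  have int_b: "integrable M b"
    by (rule integrable_const_bound[where B = 1]) (use bounds in auto)
  have int: "integrable M (\<lambda>\<omega>. p + p * b \<omega> + (q - p) * indicat_real A \<omega>)"
    using int_A int_b by simp
  show ?int using int by (subst Bochner_Integration.integrable_cong[OF refl]) (use ind in auto)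
  have int_X: "integrable M X" "expectation X = (real m + 1) / l"
    using erlang_ith_moment_integrable[OF l X, of 1] erlang_ith_moment[OF l X, of 1] by simp_all
  have "expectation b \<le> expectation X"
    by (rule integral_mono_AE[OF int_b int_X(1)]) (use b in eventually_elim, simp)
  hence Eb: "expectation b \<le> (real m + 1) / l" using int_X by simp
  have "(q - p) * prob A + p * ((real m + 1) / l) \<le> \<epsilon> * p"
  proof (cases "p = q")
    case True
    \<comment> \<open>The probability term vanishes for \<open>p = q\<close>. The assumption
      \<open>ratio\<close> covers only \<open>x > 1\<close>; any such value, here 2, bounds the
      remaining term.\<close>
    have "0 \<le> (2 - 1) * (4 * 2 / (2 + 1)\<^sup>2 :: real) ^ Suc m" by (intro mult_nonneg_nonneg zero_le_power) auto
    hence "(real m + 1) / l \<le> \<epsilon>" using ratio[of 2] by linarith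
    hence "p * ((real m + 1) / l) \<le> p * \<epsilon>" using pq by (intro mult_left_mono) auto
    thus ?thesis using True by (simp add: mult.commute)
  next
    case False
    define x where "x = q / p"
    have x: "1 < x" "q = p * x" using False pq by (auto simp: x_def)
    have "prob A \<le> prob {\<omega> \<in> space M. x * Y \<omega> \<le> X \<omega>}"
    proof (rule finite_measure_mono_AE)
      show "AE \<omega> in M. \<omega> \<in> A \<longrightarrow> \<omega> \<in> {\<omega> \<in> space M. x * Y \<omega> \<le> X \<omega>}"
        using b b'
      proof eventually_elim
        case (elim \<omega>)
        show ?case
        proof
          assume A: "\<omega> \<in> A"
          hence "p * (x * b' \<omega>) \<le> p * b \<omega>" by (simp add: A_def x mult.assoc)
          hence *: "x * b' \<omega> \<le> b \<omega>" using pq by simp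
          \<comment> \<open>Otherwise \<open>x * b'\<close> would exceed 1, the upper bound of
            \<open>b\<close>; hence \<open>b'\<close> is not truncated and equals
            \<open>Y\<close>.\<close>
          have "b' \<omega> < 1"
          proof (rule ccontr)
            assume "\<not> b' \<omega> < 1"
            hence "x * 1 \<le> x * b' \<omega>" using x by (intro mult_left_mono) auto
            with * bounds(2)[of \<omega>] x show False by linarith
          qed
          hence "b' \<omega> = Y \<omega>" using elim by auto
          moreover have "b \<omega> \<le> X \<omega>" using elim by simp
          ultimately have "x * Y \<omega> \<le> X \<omega>" using * by simp
          thus "\<omega> \<in> {\<omega> \<in> space M. x * Y \<omega> \<le> X \<omega>}" using A by (simp add: A_def)
        qed
      qed
    qed measurable
    also have "\<dots> \<le> (4 * x / (x + 1)\<^sup>2) ^ Suc m"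
      by (rule erlang_ratio_tail[OF X Y indep l x(1)])
    finally have "(x - 1) * prob A \<le> (x - 1) * (4 * x / (x + 1)\<^sup>2) ^ Suc m"
      using x by (intro mult_left_mono) auto
    hence "(x - 1) * prob A + (real m + 1) / l \<le> \<epsilon>" using ratio[OF x(1)] by linarith
    hence "p * ((x - 1) * prob A + (real m + 1) / l) \<le> p * \<epsilon>" using pq by (intro mult_left_mono) auto
    moreover have "p * ((x - 1) * prob A + (real m + 1) / l) = (q - p) * prob A + p * ((real m + 1) / l)"
      by (simp only: x(2)) (simp add: algebra_simps)
    ultimately show ?thesis by (simp add: mult.commute)
  qed
  moreover have "p * expectation b \<le> p * ((real m + 1) / l)" using Eb pq by (intro mult_left_mono) auto
  moreover have "(\<integral>\<omega>. p + p * b \<omega> + (q - p) * of_bool (q * b' \<omega> \<le> p * b \<omega>) \<partial>M)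
      = (\<integral>\<omega>. p + p * b \<omega> + (q - p) * indicat_real A \<omega> \<partial>M)"
    by (rule Bochner_Integration.integral_cong) (simp_all add: ind)
  moreover have "\<dots> = p + p * expectation b + (q - p) * prob A"
    using int_A int_b by (simp add: prob_space)
  ultimately show ?le by (simp add: algebra_simps)
qed

lemma (in prob_space) expectation_pair_cost:
  fixes X b :: "'i \<Rightarrow> 'a \<Rightarrow> real" and p :: "'i \<Rightarrow> real" and \<epsilon> :: real
  assumes X: "\<And>j. j \<in> I \<Longrightarrow> distributed M lborel (X j) (erlang_density m l)"
    and indep: "indep_vars (\<lambda>_. borel) X I" and l: "0 < l"
    and meas: "\<And>j. j \<in> I \<Longrightarrow> b j \<in> borel_measurable M"
    and bounds: "\<And>j \<omega>. 0 \<le> b j \<omega>" "\<And>j \<omega>. b j \<omega> \<le> 1"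
    and b: "\<And>j. j \<in> I \<Longrightarrow> AE \<omega> in M. b j \<omega> = min 1 (X j \<omega>)"
    and p: "\<And>j. j \<in> I \<Longrightarrow> 0 < p j"
    and ratio: "\<And>x. 1 < x \<Longrightarrow> (x - 1) * (4 * x / (x + 1)\<^sup>2) ^ Suc m + (real m + 1) / l \<le> \<epsilon>"
    and ij: "i \<in> I" "j \<in> I" "i \<noteq> j"
  shows "integrable M (\<lambda>\<omega>. pair_cost (p i) (p j) (p i * b i \<omega>) (p j * b j \<omega>))" (is "integrable M ?f")
    and "(\<integral>\<omega>. pair_cost (p i) (p j) (p i * b i \<omega>) (p j * b j \<omega>) \<partial>M) \<le> (1 + \<epsilon>) * min (p i) (p j)"
proof -
  have "integrable M ?f \<and> integral\<^sup>L M ?f \<le> (1 + \<epsilon>) * min (p i) (p j)"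
  proof (cases "p i \<le> p j")
    case True
    note * = expectation_pair_cost_aux[OF X[OF ij(1)] X[OF ij(2)] indep_vars_indep_var[OF indep ij] l
        meas[OF ij(1)] meas[OF ij(2)] bounds(1)[of i] bounds(2)[of i] b[OF ij(1)] b[OF ij(2)] p[OF ij(1)] True ratio]
    show ?thesis using * True by (simp add: pair_cost_def min_def)
  next
    case False
    hence le: "p j \<le> p i" by simp
    note * = expectation_pair_cost_aux[OF X[OF ij(2)] X[OF ij(1)]
        indep_vars_indep_var[OF indep ij(2,1) ij(3)[symmetric]] l
        meas[OF ij(2)] meas[OF ij(1)] bounds(1)[of j] bounds(2)[of j] b[OF ij(2)] b[OF ij(1)] p[OF ij(2)] le ratio]
    show ?thesis using * False by (simp add: pair_cost_def min_def)
  qed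
  thus "integrable M ?f" "integral\<^sup>L M ?f \<le> (1 + \<epsilon>) * min (p i) (p j)" by simp_all
qed

theorem theorem5:
  fixes M :: "'w measure"
    and g k n :: nat
    and p :: "nat \<Rightarrow> real"
    and T :: "nat \<Rightarrow> nat \<Rightarrow> 'w \<Rightarrow> real"
    and pick :: "nat set \<Rightarrow> nat"
    and ALG :: "'w \<Rightarrow> real"
  defines "k \<equiv> nat \<lceil>(real g / 2) powr (2 / 3)\<rceil> + 1"
    and "ALG \<equiv> (\<lambda>\<omega>. retc_cost pick (\<lambda>j. progress_bar g (\<lambda>i. T j i \<omega>)) n p
                       (real k / (real g + 1)))"
  assumes "prob_space M"
    and "g \<ge> 12"
    and "\<And>j. j < n \<Longrightarrow> p j > 0"
    and "independent_poisson_processes M n (real g) T"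
    and "\<And>S. S \<noteq> {} \<Longrightarrow> S \<subseteq> {..<n} \<Longrightarrow> pick S \<in> S"
  shows "integrable M ALG \<and>
         (\<integral>\<omega>. ALG \<omega> \<partial>M) \<le> (1 + (12 / real g) powr (1 / 3)) * OPT n p"
proof -
  interpret prob_space M by fact
  note g = \<open>g \<ge> 12\<close> and p = \<open>\<And>j. j < n \<Longrightarrow> p j > 0\<close>
    and pick = \<open>\<And>S. S \<noteq> {} \<Longrightarrow> S \<subseteq> {..<n} \<Longrightarrow> pick S \<in> S\<close>
  define K where "K = nat \<lceil>(real g / 2) powr (2 / 3)\<rceil>"
  define \<epsilon> where "\<epsilon> = (12 / real g) powr (1 / 3)"
  have k: "k = Suc K" by (simp add: k_def K_def)
  \<comment> \<open>This yields \<open>k \<le> g\<close>, so the threshold is reached at a truncated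
    Poisson point rather than at the final forced jump.\<close>
  have "(real g / 2) powr (2 / 3) \<le> (real g / 2) powr 1" using g by (intro powr_mono) auto
  also have "\<dots> \<le> real_of_int (int g - 1)" using g by simp
  finally have "\<lceil>(real g / 2) powr (2 / 3)\<rceil> \<le> int g - 1" by (rule ceiling_le)
  hence kg: "k \<le> g" using g unfolding k K_def by linarith
  define b where "b j \<omega> = ready_point g k (\<lambda>i. T j i \<omega>)" for j \<omega>
  \<comment> \<open>The \<open>k\<close>-th point has index \<open>K = k - 1\<close>, which is also
    the index of its Erlang density.\<close>
  define X where "X j = T j K" for j
  have T: "poisson_point_process M (real g) (T j)" if "j < n" for j
    using assms(6) that unfolding independent_poisson_processes_def by blast
  have meas: "b j \<in> borel_measurable M" if "j < n" for j
    unfolding b_def using T[OF that] kg unfolding poisson_point_process_def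
    by (intro measurable_ready_point) auto
  have bounds: "0 \<le> b j \<omega>" "b j \<omega> \<le> 1" for j \<omega>
    using ready_point(1,2)[where k = k and g = g and t = "\<lambda>i. T j i \<omega>"] kg by (auto simp: b_def)
  have b: "AE \<omega> in M. b j \<omega> = min 1 (X j \<omega>)" if "j < n" for j
    using poisson_point_process_AE[OF T[OF that]]
  proof eventually_elim
    case (elim \<omega>)
    thus ?case using ready_point_incseq[where k = k and g = g and t = "\<lambda>i. T j i \<omega>"] kg by (simp add: b_def X_def k)
  qed
  have X: "distributed M lborel (X j) (erlang_density K (real g))" if "j < n" for j
    unfolding X_def using poisson_point_erlang[OF T[OF that]] g by simp
  have "indep_vars (\<lambda>_. \<Pi>\<^sub>M i\<in>UNIV. borel) (\<lambda>j \<omega> i. T j i \<omega>) {..<n}"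
    using assms(6) unfolding independent_poisson_processes_def by blast
  hence "indep_vars (\<lambda>_. borel) (\<lambda>j \<omega>. (\<lambda>f. f K) (\<lambda>i. T j i \<omega>)) {..<n}"
    by (rule indep_vars_compose2) (rule measurable_component_singleton, simp)
  hence indep: "indep_vars (\<lambda>_. borel) X {..<n}" by (simp add: X_def[abs_def])
  have ratio: "(x - 1) * (4 * x / (x + 1)\<^sup>2) ^ Suc K + (real K + 1) / real g \<le> \<epsilon>" if "1 < x" for x
    unfolding \<epsilon>_def using etc_ratio_bound[OF g K_def that] .
  have pair: "integrable M (\<lambda>\<omega>. pair_cost (p i) (p j) (p i * b i \<omega>) (p j * b j \<omega>))"
    "(\<integral>\<omega>. pair_cost (p i) (p j) (p i * b i \<omega>) (p j * b j \<omega>) \<partial>M) \<le> (1 + \<epsilon>) * min (p i) (p j)"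
    if "i < j" "j < n" for i j
    using expectation_pair_cost[of "{..<n}" X K "real g" b p \<epsilon> i j] X indep g meas bounds b p ratio that
    by auto
  have ALG: "ALG \<omega> = etc_cost pick p (\<lambda>j. p j * b j \<omega>) n {..<n}" for \<omega>
    unfolding ALG_def b_def using kg p ready_point
    by (intro retc_cost_eq[OF pick]) auto
  define P where "P = {(i, j). i < j \<and> j < n}"
  define U where "U \<omega> = (\<Sum>j<n. p j)
    + (\<Sum>(i, j)\<in>P. pair_cost (p i) (p j) (p i * b i \<omega>) (p j * b j \<omega>))" for \<omega>
  have P: "P = {(i, j). i < j \<and> i \<in> {..<n} \<and> j \<in> {..<n}}" by (auto simp: P_def)
  have ALG_le: "ALG \<omega> \<le> U \<omega>" for \<omega>
    unfolding ALG U_def P by (rule etc_cost_le[OF pick]) auto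
  have ALG_nn: "0 \<le> ALG \<omega>" for \<omega>
    unfolding ALG using p bounds by (intro etc_cost_nonneg[OF pick]) (auto simp: less_imp_le)
  have ALG_meas: "ALG \<in> borel_measurable M"
  proof -
    have "(\<lambda>\<omega>. etc_cost pick p (\<lambda>j. p j * b j \<omega>) n {..<n}) \<in> borel_measurable M"
      using meas by (intro measurable_etc_cost[OF pick]) auto
    thus ?thesis by (simp flip: ALG)
  qed
  have int_pair: "integrable M (\<lambda>\<omega>. \<Sum>(i, j)\<in>P. pair_cost (p i) (p j) (p i * b i \<omega>) (p j * b j \<omega>))"
    using pair(1) by (intro Bochner_Integration.integrable_sum) (auto simp: P_def)
  hence int_U: "integrable M U" unfolding U_def[abs_def] by simp
  \<comment> \<open>The cost is measurable and lies between 0 and the integrable pair sum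
    \<open>U\<close>.\<close>
  have int_ALG: "integrable M ALG"
  proof (rule Bochner_Integration.integrable_bound[OF int_U ALG_meas], intro AE_I2)
    fix \<omega>
    show "norm (ALG \<omega>) \<le> norm (U \<omega>)" using ALG_nn[of \<omega>] ALG_le[of \<omega>] by simp
  qed
  have "expectation ALG \<le> expectation U"
    using ALG_le by (intro integral_mono int_ALG int_U)
  also have "\<dots> = (\<Sum>j<n. p j)
      + (\<Sum>(i, j)\<in>P. \<integral>\<omega>. pair_cost (p i) (p j) (p i * b i \<omega>) (p j * b j \<omega>) \<partial>M)"
    unfolding U_def[abs_def] using int_pair pair(1)
    by (subst Bochner_Integration.integral_add, simp, simp, subst Bochner_Integration.integral_sum)
       (auto simp: P_def prob_space case_prod_unfold)
  also have "\<dots> \<le> (1 + \<epsilon>) * (\<Sum>j<n. p j) + (\<Sum>(i, j)\<in>P. (1 + \<epsilon>) * min (p i) (p j))"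
  proof (intro add_mono sum_mono)
    \<comment> \<open>The diagonal sum is enlarged by the factor \<open>1 + \<epsilon>\<close> too,
      so that the bound becomes a multiple of \<open>opt_lower_bound\<close>.\<close>
    have "0 \<le> \<epsilon> * (\<Sum>j<n. p j)" using p by (intro mult_nonneg_nonneg sum_nonneg) (auto simp: \<epsilon>_def less_imp_le)
    thus "(\<Sum>j<n. p j) \<le> (1 + \<epsilon>) * (\<Sum>j<n. p j)" by (simp add: distrib_right)
  qed (use pair(2) in \<open>auto simp: P_def\<close>)
  also have "\<dots> = (1 + \<epsilon>) * opt_lower_bound n p"
    unfolding opt_lower_bound_def P_def by (simp add: distrib_left sum_distrib_left case_prod_unfold)
  also have "\<dots> \<le> (1 + \<epsilon>) * OPT n p"
    using opt_lower_bound_le_OPT[of n p] p by (intro mult_left_mono) (auto simp: \<epsilon>_def)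
  finally show ?thesis using int_ALG unfolding \<epsilon>_def by blast
qed

end
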